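(* Let $G,F$ be locally compact groups, $\rho:F\to\mathrm{Aut}(G)$ a group homomorphism such that $(g,f)\mapsto\rho_f(g)$ is continuous, and $H=G\rtimes_\rho F$. Let $\mathfrak C$ be a category and $\mathcal T=\langle S,J,\mathcal Z,\mathcal S,\mathcal F,m,W,H,\mathbf D,\mathbf U\rangle$ a nucleon-fragment doublet on $\mathfrak C$ (with symmetry map constantly $H$), and let $\Xi=\mathcal F^{-1}(\mathrm{Dom}(\mathbf D)^0)$. With the notation of the context, for each $j\in\{m,w\}$: (1) $\mu_j^{\mathcal T},\lambda_j^{\mathcal T}\in\mathrm{Mor}_{\mathsf{Fct}(\Xi^{op},\mathsf{set})}(\mathcal P^{\mathcal T},\mathsf R^{\mathcal T})$. (2) For all $a\in\Xi$, $(\mu_j^{\mathcal T})_a$ and $(\lambda_j^{\mathcal T})_a$ are morphisms of $H$-sets from $\mathsf Q_a^{\mathcal T}$ to $\mathsf R^H$. (3) $\theta^{\mathcal T}\in\mathrm{Mor}_{\mathsf{Fct}(\Xi^{op},\mathsf{set})}(\mathcal P^{\mathcal T},\mathsf R^{\mathcal T})$, and for all $a\in\Xi$, $\theta_a^{\mathcal T}$ is a morphism of $H$-sets from $\mathsf Q_a^{\mathcal T}$ to $\mathsf R^H$. Equivalently, for $\chi\in\{\mu_j^{\mathcal T},\lambda_j^{\mathcal T},\theta^{\mathcal T}\}$: $\chi_{d(T)}\circ\mathcal P^{\mathcal T}(T)=\chi_{c(T)}$ for all $T\in\mathrm{Mor}_\Xi$, and $\chi_a\circ\tau_a^{\mathcal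 T}(l)=\chi_a$ for all $a\in\Xi$, $l\in H$.
   Context: GENERAL NOTATION. $H=G\rtimes_\rho F$ has product $(g_1,h_1)(g_2,h_2)=(g_1\rho_{h_1}(g_2),h_1h_2)$; $j_1:G\to H$, $j_2:F\to H$ are the canonical injections, $\mathrm{Pr}_2:H\to F$ the projection, $\mathrm{ad}(l)(h)=lhl^{-1}$. $\mathsf{set}$ is the category of (small) sets; $d(t),c(t)$ are domain and codomain of a morphism. For a locally compact group $K$, $\mathsf C(K)$ is the category of $C^*$-dynamical systems $\langle A,K,\sigma\rangle$ with $A$ unital and surjective equivariant $*$-homomorphisms. For a system $\langle A,H,\sigma\rangle$ and $\omega\in A^*$: $F_\omega=\{h\in F:\omega\circ\sigma(j_2(h))=\omega\}$, $S_\omega=G\rtimes_\rho F_\omega$, $E^G_A$ is the set of states with $\omega\circ\sigma(j_1(g))=\omega$ for all $g\in G$. For a closed subgroup $S$ of $H$ with Haar measure $\mu$, $A\rtimes_\sigma^\mu S$ is the $C^*$-crossed product (completion of $C_c(S,A)$, convolution w.r.t. $\mu$). $B^+=B\times\mathbb C$ is the unitization; $\tilde R(b,\lambda)=R(b)+\lambda 1$ for a representation $R$ of $B$, $\alpha^+(b,\lambda)=(\alpha(b),\lambda)$ for a $*$-homomorphism; $M(B)$ is the multiplier algebra, $\mathfrak i^B:B\to M(B)$ the embedding; a nondegenerate $*$-homomorphism $\alpha:B\to M(C)$ extends uniquely to $\alpha^-:M(B)\to M(C)$ with $\alpha^-\circ\mathfrak i^B=\alpha$; a state $\psi$ of $B$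 has a unique extension to a state $\psi^-$ of $M(B)$; for $B=A\rtimes^\mu_\sigma S$, $\mathfrak j:A\to M(B)$ is $(\mathfrak j(a)f)(s)=af(s)$. $(\pi\rtimes^\mu W)(f)=\int\pi(f(s))W(s)\,d\mu(s)$. If $\omega\in E_A^G$ has GNS triple $(\mathcal H,\pi,\Omega)$, $U:S_\omega\to U(\mathcal H)$ is $U(s)\pi(a)\Omega=\pi(\sigma(s)a)\Omega$. A state is $\pi$-normal if it is $\phi\circ\pi$ with $\phi$ a normal state of $\mathcal L(\mathcal H)$. For a nonzero bounded functional $\phi$ on a unital $C^*$-algebra with Jordan decomposition $\frac12(\phi+\phi^* )=\phi_1-\phi_2$, $\phi^\natural=(\phi_1+\phi_2)/\|\phi_1+\phi_2\|$. An even $\theta$-summable $K$-cycle $(C,\pi,D,\Gamma)$: $\pi$ a unital representation of $C$, $D\neq0$ selfadjoint with compact resolvent, $[D,\pi(a)]$ defined and bounded on $\mathrm{Dom}(D)$ for all $a\in C$, $\mathrm{Tr}(e^{-D^2})<\infty$, $\Gamma$ a selfadjoint unitary commuting with $\pi(C)$, $\Gamma D\Gamma=-D$; $\mathrm{ch}(C,\pi,D,\Gamma)$ is its Chern-Connes character (class of the JLO cocycle) and $\langle\cdot,\cdot\rangle$ is Connes' pairing of $K_0(C)$ with even entire cyclic cohomology. For a system $\langle A,\mathbb R,\eta\rangle$, $\eta$-KMS states are the states $\omega$ with $\omega(a\,\overline\eta(-i)b)=\omega(ba)$ for $a,b$ in a norm-dense $\eta$-invariant $*$-algebra of entire analytic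 elements. THE CATEGORY $\mathfrak G=\mathfrak G(G,F,\rho)$. An object $\mathcal N$ consists of: a set $\mathbf T_{\mathcal N}$; for $Q\in\mathbf T_{\mathcal N}$ a set $\mathsf I^Q$, $\beta_c^Q\in\mathsf I^Q$, $\mathsf P^Q_{\mathcal N}\subseteq\mathsf I^Q$; for $\alpha\in\mathsf I^Q$ objects $\langle A(\mathcal N)^Q_\alpha,H,\eta^Q_\alpha\rangle\in\mathsf C(H)$ and $\langle A(\mathcal N)^Q_\alpha,\mathbb R,\varepsilon^Q_\alpha\rangle\in\mathsf C(\mathbb R)$, and a state $\varphi^Q_\alpha\in E^G_{A(\mathcal N)^Q_\alpha}$; an abelian group $\mathsf A_{\mathcal N}$; group morphisms $\psi^{\mathcal N}:H\to\mathrm{Aut}(\mathsf A_{\mathcal N})$, $\mathfrak b^{\mathcal N}:H\to\mathrm{Aut}_{\mathsf{set}}(\mathbf T_{\mathcal N})$ (write $Q^l=\mathfrak b^{\mathcal N}(l)Q$); a group morphism $\mathsf m^{\mathcal N}:\mathsf A_{\mathcal N}\to\prod_Q\mathrm{Map}(\mathsf P^Q_{\mathcal N},\mathbb R)$; and data $(\mu,\mathfrak u,\mathcal H,D,\Gamma,\mathfrak v,\mathfrak w,\mathfrak z)$; such that for all $Q,\alpha$ and $l,h\in H$: $\mathsf I^{Q^l}=\mathsf I^Q$, $\beta_c^{Q^l}=\beta_c^Q$, $\mathrm{ad}(\mathrm{Pr}_2(l))(F_{\varphi^Q_\alpha})=F_{\varphi_\alpha^{Q^l}}$; $\mathsf P_{\mathcal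 N}^Q=\{\alpha\in\mathsf I^Q:F_{\varphi_\alpha^Q}\supseteq F_{\varphi^Q_{\beta_c^Q}}\}$; $\mathsf m(\psi(l)f)(Q)=\mathsf m(f)(Q^{l^{-1}})$; $\varphi_\alpha^Q$ is $\varepsilon_\alpha^Q$-KMS and $\varepsilon_\alpha^{Q^l}(t)=\eta_\alpha^Q(l)\varepsilon_\alpha^Q(t)\eta_\alpha^Q(l)^{-1}$; $\mathsf m(f)(Q)$ is $\mathbb Z$-valued; and for $\alpha\in\mathsf P^Q$: $\mu^Q_\alpha$ is a Haar measure on $S_{\varphi_\alpha^Q}$, $B_\alpha^Q=A(\mathcal N)_\alpha^Q\rtimes^{\mu^Q_\alpha}S_{\varphi_\alpha^Q}$, $\mathfrak u_\alpha^Q\in\mathrm{Hom}(\mathsf A_{\mathcal N},K_0((B_\alpha^Q)^+))$, $(\mathcal H_\alpha^Q,\pi_\alpha^Q,\Omega_\alpha^Q)$ is a GNS triple of $\varphi_\alpha^Q$, $R_\alpha^Q=\pi_\alpha^Q\rtimes U$, $D^Q_\alpha,\Gamma_\alpha^Q$ are selfadjoint in $\mathcal H_\alpha^Q$ and $((B_\alpha^Q)^+,\tilde R_\alpha^Q,D_\alpha^Q,\Gamma_\alpha^Q)$ is an even $\theta$-summable $K$-cycle; $\mathfrak v_\alpha^Q(l):\mathcal H^Q_\alpha\to\mathcal H_\alpha^{Q^l}$ is unitary, $\mathfrak w_\alpha^Q(l):B_\alpha^Q\to B_\alpha^{Q^l}$ and $\mathfrak z_\alpha^Q(l):A(\mathcal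 N)_\alpha^Q\to A(\mathcal N)_\alpha^{Q^l}$ are $*$-homomorphisms; $\eta_\alpha^{Q^l}(h)\mathfrak z_\alpha^Q(l)=\mathfrak z_\alpha^Q(l)\eta_\alpha^Q(h)$; for $\mathfrak g\in\{\mathfrak v,\mathfrak w,\mathfrak z\}$, $\mathfrak g_\alpha^Q(hl)=\mathfrak g_\alpha^{Q^l}(h)\mathfrak g_\alpha^Q(l)$, $\mathfrak g_\alpha^Q(1)=\mathrm{Id}$; $D_\alpha^{Q^l}=\mathfrak v_\alpha^Q(l)D_\alpha^Q\mathfrak v_\alpha^Q(l)^{-1}$ and likewise for $\Gamma$; $R_\alpha^{Q^l}\circ\mathfrak w_\alpha^Q(l)=\mathrm{ad}(\mathfrak v_\alpha^Q(l))\circ R_\alpha^Q$; $\mathfrak u_\alpha^{Q^l}\circ\psi(l)=K_0(\mathfrak w_\alpha^Q(l)^+)\circ\mathfrak u_\alpha^Q$; $(\mathfrak i^{B_\alpha^{Q^l}}\circ\mathfrak w_\alpha^Q(l))^-\circ\mathfrak j_\alpha^Q=\mathfrak j_\alpha^{Q^l}\circ\eta_\alpha^{Q^l}(l)\circ\mathfrak z_\alpha^Q(l)$; $\mathsf m(f)(Q)(\alpha)=\langle\mathfrak u_\alpha^Q(f),\mathrm{ch}((B_\alpha^Q)^+,\tilde R_\alpha^Q,D_\alpha^Q,\Gamma_\alpha^Q)\rangle$. A morphism $\mathcal N^1\to\mathcal N^2$ is a pair $(\mathfrak g,\mathfrak d)$, $\mathfrak g\in\mathrm{Hom}(\mathsf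 A_{\mathcal N^1},\mathsf A_{\mathcal N^2})$, $\mathfrak d:\mathbf T_{\mathcal N^2}\to\mathbf T_{\mathcal N^1}$, with $\mathsf P_{\mathcal N^1}^{\mathfrak d(Q)}=\mathsf P_{\mathcal N^2}^Q$ and $\mathsf m^{\mathcal N^2}(\mathfrak g(f))(Q)=\mathsf m^{\mathcal N^1}(f)(\mathfrak d(Q))$; $(\mathfrak h,\mathfrak s)\circ(\mathfrak g,\mathfrak d)=(\mathfrak h\circ\mathfrak g,\mathfrak d\circ\mathfrak s)$. Put $\mathsf A^*_{\mathcal N}=\mathrm{Hom}(\mathsf A_{\mathcal N},\mathbb R)$, $V(\mathcal N)_\alpha^Q(l)=\mathfrak z_\alpha^Q(l)\circ\eta_\alpha^Q(l)$. For $c\in\mathsf A^*_{\mathcal N}$, $\mathrm{Rep}^{\mathcal N}(c)$ is the set of $r=(Q,\alpha,\nu,u,\mathcal K,\Phi)$ with $Q\in\mathbf T_{\mathcal N}$, $\alpha\in\mathsf P^Q_{\mathcal N}$, $\nu$ a Haar measure on $S_{\varphi_\alpha^Q}$, $u\in\mathrm{Hom}(\mathsf A_{\mathcal N},K_0(B_\nu^+))$ with $B_\nu=A(\mathcal N)_\alpha^Q\rtimes^\nu S_{\varphi^Q_\alpha}$, $\mathcal K$ a GNS triple (with representation $\pi$) of $\varphi_\alpha^Q$, $\Phi$ an entire normalized even cocycle on $B_\nu^+$ with $\Phi_0|_{B_\nu}\ne0$ ($\Phi_0$ its $0$-dimensional component), $\varrho_r:=(\Phi_0^\natural|_{B_\nu})^-\circ\mathfrak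 j$ being $\pi$-normal, and $c=\mathrm{Re}\langle u(\cdot),[\Phi]\rangle$. $\mathfrak N^{\mathcal N}(c)=\{\varrho_r:r\in\mathrm{Rep}^{\mathcal N}(c)\}$. NUCLEON-FRAGMENT DOUBLET on $\mathfrak C$ (symmetry map constantly $H$): a tuple $\mathcal T=\langle S,J,\mathcal Z,\mathcal S,\mathcal F,m,W,H,\mathbf D,\mathbf U\rangle$ as follows. $\mathbf U$ is a function on a set $\mathrm{Dom}(\mathbf U)$ of objects of $\mathfrak G$ with $\mathbf U_{\mathcal N}\subseteq\mathbf T_{\mathcal N}$ and $\mathfrak f(\mathbf U_{\mathcal M})\subseteq\mathbf U_{\mathcal N}$ for all morphisms $(\mathfrak h,\mathfrak f):\mathcal N\to\mathcal M$ between objects of $\mathrm{Dom}(\mathbf U)$; $\mathbf D$ is a function with $\mathrm{Dom}(\mathbf D)\subseteq\mathrm{Dom}(\mathbf U)$, $\mathbf D_{\mathcal N}\subseteq\mathbf U_{\mathcal N}$, $\mathfrak b^{\mathcal N}(l)\mathbf D_{\mathcal N}\subseteq\mathbf D_{\mathcal N}$ for $l\in H$; $\mathrm{Dom}(\mathbf U)$ is viewed as a full subcategory, and $\mathrm{Dom}(\mathbf D)^0$ is the subcategory with objects $\mathrm{Dom}(\mathbf D)$ and morphisms $(\mathfrak h,\mathfrak f):\mathcal N\to\mathcal M$ with $\mathfrak f(\mathbf D_{\mathcal M})\subseteq\mathbf D_{\mathcal N}$. $\mathcal F:\mathfrak C\to\mathfrak G$ is a functor, $\mathcal F(t)=(\mathcal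 F_1(t),\mathcal F_2(t))$; $\Theta=\mathcal F^{-1}(\mathrm{Dom}(\mathbf U))$, $\Xi=\mathcal F^{-1}(\mathrm{Dom}(\mathbf D)^0)$. $S:\Theta^{op}\to\mathsf{set}$ is a functor with $S^a\subseteq\mathsf A^*_{\mathcal F(a)}$, $S(t)(u)=u\circ\mathcal F_1(t)$, $\{u\circ\psi^{\mathcal F(a)}(h^{-1}):u\in S^a\}=S^a$ for $h\in H$. $m^a(Q,\cdot):\mathsf P^Q_{\mathcal F(a)}\to S^a$ for $a\in\Theta$, $Q\in\mathbf U_{\mathcal F(a)}$, with $m^{d(t)}(\mathcal F_2(t)Q,\alpha)=m^{c(t)}(Q,\alpha)\circ\mathcal F_1(t)$ for $t\in\mathrm{Mor}_\Theta$ and $m^a(Q^l,\alpha)=m^a(Q,\alpha)\circ\psi^{\mathcal F(a)}(l^{-1})$ for $l\in H$. With $Z(\mathcal N)=\coprod_{Q\in\mathbf T_{\mathcal N}}\prod_{\beta\in\mathsf P_{\mathcal N}^Q}(A(\mathcal N)_\beta^Q)^*$ and $V_\diamond(\mathcal N)(l)(Q,f)=(Q^l,\alpha\mapsto f(\alpha)\circ V(\mathcal N)_\alpha^{Q^l}(l^{-1}))$: $\mathcal Z:\Xi^{op}\to\mathsf{set}$ is a functor with $\mathcal Z(x)=Z(\mathcal F(x))$; $\mathcal S(t,Q,\beta):A(\mathcal F(d(t)))_\beta^{\mathcal F_2(t)Q}\to A(\mathcal F(c(t)))_\beta^Q$ are $*$-homomorphisms ($t\in\mathrm{Mor}_\Xi$,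 $Q\in\mathbf T_{\mathcal F(c(t))}$, $\beta\in\mathsf P^Q$) with $\mathcal S(t\circ s,Q,\beta)=\mathcal S(t,Q,\beta)\circ\mathcal S(s,\mathcal F_2(t)Q,\beta)$; $\mathcal Z(t)(Q,f)=(\mathcal F_2(t)Q,\beta\mapsto f(\beta)\circ\mathcal S(t,Q,\beta))$. $J:\Xi^{op}\to\mathsf{set}$ is a functor with $J^b\subset\mathcal Z(b)$, $J(t)=\mathcal Z(t)|_{J^{c(t)}}$, $J^b\subset\coprod_{Q\in\mathbf D_{\mathcal F(b)}}\prod_\beta\mathfrak N^{\mathcal F(b)}(m^b(Q,\beta))$, $V_\diamond(\mathcal F(b))(l)J^b=J^b$. $W^b(Q,\beta)\in\mathfrak N^{\mathcal F(b)}(m^b(Q,\beta))$ for $b\in\Xi,Q\in\mathbf D_{\mathcal F(b)}$, of the form $\varrho_r$ with $r\in\mathrm{Rep}^{\mathcal F(b)}(m^b(Q,\beta))$ having first components $Q,\beta$; $(Q,W^b(Q))\in J^b$; $W^{d(t)}(\mathcal F_2(t)Q,\beta)=W^{c(t)}(Q,\beta)\circ\mathcal S(t,Q,\beta)$ for $t\in\mathrm{Mor}_\Xi$; $W^b(Q^l,\beta)=W^b(Q,\beta)\circ V(\mathcal F(b))_\beta^{Q^l}(l^{-1})$ for $l\in H$. FISSION PROCESSES. Write $A(a,Q,\alpha)=A(\mathcal F(a))_\alpha^Q$, $Q^T=\mathcal F_2(T)Q$. $\mathsf N_{as}^{\mathcal T}$ is the set of $\mathfrak n=\langle a,Q,\alpha,\{f_j,N_j\}_{j\in\{m,w\}}\rangle$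 with $a\in\Xi$, $Q\in\mathbf D_{\mathcal F(a)}$, $\alpha\in\mathsf P^Q_{\mathcal F(a)}$ a real number $>0$, $f_j\in\mathsf A_{\mathcal F(a)}$, $N_j\in A(a,Q,\alpha)_+$, $W^a(Q,\alpha)(N_j)\ge m^a(Q,\alpha)(f_j)$, $m^a(Q,\alpha)(f_w)\ge m^a(Q,\alpha)(f_m)\ge0$, and for every $T\in\mathrm{Mor}_\Xi$ with $c(T)=a$: $\mathcal F_1(T)^{-1}(f_j)\neq\varnothing$, $\mathcal S(T,Q,\alpha)^{-1}(N_j)\cap A(d(T),Q^T,\alpha)_+\ne\varnothing$. $\mathsf N_{as}^{\mathcal T}(a)$ is the subset with first entry $a$. $\zeta_j(\mathfrak n)=m^a(Q,\alpha)(f_j)$, $\kappa_j(\mathfrak n)=W^a(Q,\alpha)(N_j)$, $\nu=0.08(\kappa_m-\zeta_m)+0.1(\kappa_w-\zeta_w)$. $\mathfrak k(l)(\mathfrak n)=\langle a,Q^l,\alpha,\{\psi^{\mathcal F(a)}(l)f_j,V(\mathcal F(a))_\alpha^Q(l)N_j\}_j\rangle$. $\mathcal P^{\mathcal T}:\Xi^{op}\to\mathsf{set}$ is the functor with $\mathcal P^{\mathcal T}(a)$ the power set of $\mathsf N_{as}^{\mathcal T}(a)$ and $\mathcal P^{\mathcal T}(T)(Y)=\bigcup_{\mathfrak n\in Y}\varrho(T)(\mathfrak n)$, where $\varrho(T)(\langle c(T),Q,\alpha,\{f_j,N_j\}\rangle)=\{\langle d(T),Q^T,\alpha,\{x_j,y_j\}\rangle:x_j\in\mathcal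 F_1(T)^{-1}(f_j),\ y_j\in\mathcal S(T,Q,\alpha)^{-1}(N_j)\cap A(d(T),Q^T,\alpha)_+\}$. $\mathsf R^{\mathcal T}$ is the constant functor $\Xi^{op}\to\mathsf{set}$ with value $\mathscr P(\mathbb R)$; $\mathsf R^H$ is $\mathscr P(\mathbb R)$ with trivial $H$-action; $\mathsf Q_a^{\mathcal T}$ is $\mathcal P^{\mathcal T}(a)$ with action $\tau_a^{\mathcal T}(l)Y=\{\mathfrak k(l)(y):y\in Y\}$. For $Y\in\mathcal P^{\mathcal T}(a)$: $(\mu_j^{\mathcal T})_a(Y)=\{\zeta_j(y):y\in Y\}$, $(\lambda_j^{\mathcal T})_a(Y)=\{\kappa_j(y):y\in Y\}$, $\theta_a^{\mathcal T}(Y)=\{\nu(y):y\in Y\}$.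
   Formalization: The definitions do not make P^T a functor or Q_a^T an H-set in general, so the claims of being morphisms of functors and of H-sets are stated whenever these hold; the equations of the last sentence are stated without this condition. *)

theory Defs
  imports "HOL-Analysis.Analysis" "HOL-Algebra.Group_Action"
begin

text \<open>
  C*-algebras, Hilbert spaces, crossed products and K-groups vary with indices here, so all of
  them are records with explicit carrier sets. Maps between carriers are extensional in the
  sense of the library (\<^const>\<open>extensional\<close>), so that equality of functions is equality of maps
  on the carrier; abelian groups, automorphism groups and actions are those of
  \<^theory>\<open>HOL-Algebra.Group_Action\<close> and its parents. ``The unique object such that'' is rendered
  with \<^term>\<open>The\<close>.
\<close>

section \<open>Topological groups\<close>

definition locally_compact_group :: "('k, 'z) monoid_scheme \<Rightarrow> 'k topology \<Rightarrow> bool" where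
  "locally_compact_group K X \<longleftrightarrow>
     group K \<and> topspace X = carrier K \<and>
     continuous_map (prod_topology X X) X (\<lambda>(x, y). x \<otimes>\<^bsub>K\<^esub> y) \<and>
     continuous_map X X (\<lambda>x. inv\<^bsub>K\<^esub> x) \<and>
     locally_compact_space X \<and> Hausdorff_space X"

definition real_group :: "real monoid" where
  "real_group = \<lparr>carrier = UNIV, mult = (+), one = 0\<rparr>"

definition Hom :: "('a, 'y) monoid_scheme \<Rightarrow> ('b, 'z) monoid_scheme \<Rightarrow> ('a \<Rightarrow> 'b) set" where
  "Hom A B = hom A B \<inter> extensional (carrier A)"

text \<open>The data \<open>(G, F, \<rho>)\<close> together with the topologies of \<open>G\<close> and \<open>F\<close>.\<close>

record ('g, 'f) sd_data =
  grpG :: "'g monoid"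
  topG :: "'g topology"
  grpF :: "'f monoid"
  topF :: "'f topology"
  rho  :: "'f \<Rightarrow> 'g \<Rightarrow> 'g"

definition sd_group :: "('g, 'f) sd_data \<Rightarrow> ('g \<times> 'f) monoid" where
  "sd_group E =
     \<lparr>carrier = carrier (grpG E) \<times> carrier (grpF E),
      mult = (\<lambda>(g1, h1) (g2, h2). (g1 \<otimes>\<^bsub>grpG E\<^esub> rho E h1 g2, h1 \<otimes>\<^bsub>grpF E\<^esub> h2)),
      one = (\<one>\<^bsub>grpG E\<^esub>, \<one>\<^bsub>grpF E\<^esub>)\<rparr>"

definition sd_top :: "('g, 'f) sd_data \<Rightarrow> ('g \<times> 'f) topology" where
  "sd_top E = prod_topology (topG E) (topF E)"

definition j1 :: "('g, 'f) sd_data \<Rightarrow> 'g \<Rightarrow> 'g \<times> 'f" where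
  "j1 E g = (g, \<one>\<^bsub>grpF E\<^esub>)"

definition j2 :: "('g, 'f) sd_data \<Rightarrow> 'f \<Rightarrow> 'g \<times> 'f" where
  "j2 E h = (\<one>\<^bsub>grpG E\<^esub>, h)"

text \<open>Haar measures: nonzero left invariant Radon measures on the Borel sets of \<open>X\<close>.\<close>

definition haar_measure :: "('k, 'z) monoid_scheme \<Rightarrow> 'k topology \<Rightarrow> 'k measure \<Rightarrow> bool" where
  "haar_measure K X \<mu> \<longleftrightarrow>
     space \<mu> = carrier K \<and>
     sets \<mu> = sigma_sets (carrier K) {U. openin X U} \<and>
     emeasure \<mu> (carrier K) \<noteq> 0 \<and>
     (\<forall>C. compactin X C \<longrightarrow> emeasure \<mu> C < \<infinity>) \<and>
     (\<forall>E\<in>sets \<mu>. emeasure \<mu> E = (INF U\<in>{U. openin X U \<and> E \<subseteq> U}. emeasure \<mu> U)) \<and>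
     (\<forall>U. openin X U \<longrightarrow> emeasure \<mu> U = (SUP C\<in>{C. compactin X C \<and> C \<subseteq> U}. emeasure \<mu> C)) \<and>
     (\<forall>s\<in>carrier K. \<forall>E\<in>sets \<mu>. emeasure \<mu> ((\<lambda>x. s \<otimes>\<^bsub>K\<^esub> x) ` E) = emeasure \<mu> E)"

text \<open>Modular function, normalized by \<open>\<Delta>(s) \<integral> f(r s) d\<mu>(r) = \<integral> f(r) d\<mu>(r)\<close>.\<close>

definition modular_fun :: "('k, 'z) monoid_scheme \<Rightarrow> 'k topology \<Rightarrow> 'k measure \<Rightarrow> 'k \<Rightarrow> real" where
  "modular_fun K X \<mu> s = (THE d. d > 0 \<and>
     (\<forall>f::'k \<Rightarrow> real. continuous_map X euclideanreal f \<longrightarrow>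
        (\<exists>C. compactin X C \<and> (\<forall>x\<in>carrier K - C. f x = 0)) \<longrightarrow>
        d * (LINT r|\<mu>. f (r \<otimes>\<^bsub>K\<^esub> s)) = (LINT r|\<mu>. f r)))"


section \<open>C*-algebras and Hilbert spaces with carrier sets\<close>

record 'a cvec =
  vcar  :: "'a set"
  vzero :: 'a
  vadd  :: "'a \<Rightarrow> 'a \<Rightarrow> 'a"
  vscl  :: "complex \<Rightarrow> 'a \<Rightarrow> 'a"

record 'a calg = "'a cvec" +
  amul  :: "'a \<Rightarrow> 'a \<Rightarrow> 'a"
  astar :: "'a \<Rightarrow> 'a"
  anrm  :: "'a \<Rightarrow> real"

record 'a hsp = "'a cvec" +
  hinn :: "'a \<Rightarrow> 'a \<Rightarrow> complex"

definition vsub :: "('a, 'z) cvec_scheme \<Rightarrow> 'a \<Rightarrow> 'a \<Rightarrow> 'a" where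
  "vsub V x y = vadd V x (vscl V (-1) y)"

primrec vsum :: "('a, 'z) cvec_scheme \<Rightarrow> (nat \<Rightarrow> 'a) \<Rightarrow> nat \<Rightarrow> 'a" where
  "vsum V f 0 = vzero V"
| "vsum V f (Suc n) = vadd V (vsum V f n) (f n)"

definition cvec_space :: "('a, 'z) cvec_scheme \<Rightarrow> bool" where
  "cvec_space V \<longleftrightarrow>
     comm_group \<lparr>carrier = vcar V, mult = vadd V, one = vzero V\<rparr> \<and>
     (\<forall>a. \<forall>x\<in>vcar V. vscl V a x \<in> vcar V \<and> vscl V 1 x = x) \<and>
     (\<forall>a b. \<forall>x\<in>vcar V. vscl V a (vscl V b x) = vscl V (a * b) x \<and>
        vscl V (a + b) x = vadd V (vscl V a x) (vscl V b x)) \<and>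
     (\<forall>a. \<forall>x\<in>vcar V. \<forall>y\<in>vcar V. vscl V a (vadd V x y) = vadd V (vscl V a x) (vscl V a y))"

definition linear_maps :: "('a, 'y) cvec_scheme \<Rightarrow> ('b, 'z) cvec_scheme \<Rightarrow> ('a \<Rightarrow> 'b) set" where
  "linear_maps V W = {f \<in> vcar V \<rightarrow>\<^sub>E vcar W.
     (\<forall>x\<in>vcar V. \<forall>y\<in>vcar V. f (vadd V x y) = vadd W (f x) (f y)) \<and>
     (\<forall>a. \<forall>x\<in>vcar V. f (vscl V a x) = vscl W a (f x))}"

definition ndist :: "('a, 'z) cvec_scheme \<Rightarrow> ('a \<Rightarrow> real) \<Rightarrow> 'a \<Rightarrow> 'a \<Rightarrow> real" where
  "ndist V n x y = (if x \<in> vcar V \<and> y \<in> vcar V then n (vsub V x y) else 0)"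

definition ntop :: "('a, 'z) cvec_scheme \<Rightarrow> ('a \<Rightarrow> real) \<Rightarrow> 'a topology" where
  "ntop V n = Metric_space.mtopology (vcar V) (ndist V n)"

definition ncomplete :: "('a, 'z) cvec_scheme \<Rightarrow> ('a \<Rightarrow> real) \<Rightarrow> bool" where
  "ncomplete V n \<longleftrightarrow> Metric_space.mcomplete (vcar V) (ndist V n)"

definition cstar_algebra :: "'a calg \<Rightarrow> bool" where
  "cstar_algebra A \<longleftrightarrow>
     cvec_space A \<and>
     (\<forall>x\<in>vcar A. \<forall>y\<in>vcar A. amul A x y \<in> vcar A) \<and>
     (\<forall>x\<in>vcar A. \<forall>y\<in>vcar A. \<forall>z\<in>vcar A.
        amul A (amul A x y) z = amul A x (amul A y z) \<and>
        amul A (vadd A x y) z = vadd A (amul A x z) (amul A y z) \<and>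
        amul A z (vadd A x y) = vadd A (amul A z x) (amul A z y)) \<and>
     (\<forall>a. \<forall>x\<in>vcar A. \<forall>y\<in>vcar A.
        amul A (vscl A a x) y = vscl A a (amul A x y) \<and>
        amul A x (vscl A a y) = vscl A a (amul A x y)) \<and>
     (\<forall>x\<in>vcar A. astar A x \<in> vcar A \<and> astar A (astar A x) = x) \<and>
     (\<forall>x\<in>vcar A. \<forall>y\<in>vcar A.
        astar A (vadd A x y) = vadd A (astar A x) (astar A y) \<and>
        astar A (amul A x y) = amul A (astar A y) (astar A x)) \<and>
     (\<forall>a. \<forall>x\<in>vcar A. astar A (vscl A a x) = vscl A (cnj a) (astar A x)) \<and>
     (\<forall>x\<in>vcar A. 0 \<le> anrm A x \<and> (anrm A x = 0 \<longleftrightarrow> x = vzero A)) \<and>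
     (\<forall>a. \<forall>x\<in>vcar A. anrm A (vscl A a x) = cmod a * anrm A x) \<and>
     (\<forall>x\<in>vcar A. \<forall>y\<in>vcar A.
        anrm A (vadd A x y) \<le> anrm A x + anrm A y \<and>
        anrm A (amul A x y) \<le> anrm A x * anrm A y) \<and>
     (\<forall>x\<in>vcar A. anrm A (amul A (astar A x) x) = (anrm A x)\<^sup>2) \<and>
     ncomplete A (anrm A)"

definition is_aunit :: "'a calg \<Rightarrow> 'a \<Rightarrow> bool" where
  "is_aunit A e \<longleftrightarrow> e \<in> vcar A \<and> (\<forall>x\<in>vcar A. amul A e x = x \<and> amul A x e = x)"

definition aunit :: "'a calg \<Rightarrow> 'a" where
  "aunit A = (THE e. is_aunit A e)"

definition unital_cstar_algebra :: "'a calg \<Rightarrow> bool" where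
  "unital_cstar_algebra A \<longleftrightarrow> cstar_algebra A \<and> (\<exists>e. is_aunit A e)"

definition star_homs :: "'a calg \<Rightarrow> 'b calg \<Rightarrow> ('a \<Rightarrow> 'b) set" where
  "star_homs A B = {f \<in> linear_maps A B.
     (\<forall>x\<in>vcar A. \<forall>y\<in>vcar A. f (amul A x y) = amul B (f x) (f y)) \<and>
     (\<forall>x\<in>vcar A. f (astar A x) = astar B (f x))}"

definition unital_star_homs :: "'a calg \<Rightarrow> 'b calg \<Rightarrow> ('a \<Rightarrow> 'b) set" where
  "unital_star_homs A B = {f \<in> star_homs A B. f (aunit A) = aunit B}"

definition pos_cone :: "'a calg \<Rightarrow> 'a set" where
  "pos_cone A = {amul A (astar A b) b | b. b \<in> vcar A}"

definition dual :: "'a calg \<Rightarrow> ('a \<Rightarrow> complex) set" where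
  "dual A = {f \<in> extensional (vcar A).
     (\<forall>x\<in>vcar A. \<forall>y\<in>vcar A. f (vadd A x y) = f x + f y) \<and>
     (\<forall>a. \<forall>x\<in>vcar A. f (vscl A a x) = a * f x) \<and>
     (\<exists>C. \<forall>x\<in>vcar A. cmod (f x) \<le> C * anrm A x)}"

definition dual_nrm :: "'a calg \<Rightarrow> ('a \<Rightarrow> complex) \<Rightarrow> real" where
  "dual_nrm A f = Sup {cmod (f x) | x. x \<in> vcar A \<and> anrm A x \<le> 1}"

definition pos_functional :: "'a calg \<Rightarrow> ('a \<Rightarrow> complex) \<Rightarrow> bool" where
  "pos_functional A f \<longleftrightarrow> f \<in> dual A \<and> (\<forall>x\<in>pos_cone A. f x \<in> \<real> \<and> 0 \<le> Re (f x))"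

definition is_state :: "'a calg \<Rightarrow> ('a \<Rightarrow> complex) \<Rightarrow> bool" where
  "is_state A f \<longleftrightarrow> pos_functional A f \<and> dual_nrm A f = 1"

text \<open>The Jordan decomposition of the real part of a functional and the state \<open>\<phi>\<^sup>\<natural>\<close>.\<close>

definition re_functional :: "'a calg \<Rightarrow> ('a \<Rightarrow> complex) \<Rightarrow> 'a \<Rightarrow> complex" where
  "re_functional A f = (\<lambda>x\<in>vcar A. (f x + cnj (f (astar A x))) / 2)"

definition is_jordan :: "'a calg \<Rightarrow> ('a \<Rightarrow> complex) \<Rightarrow> ('a \<Rightarrow> complex) \<Rightarrow> ('a \<Rightarrow> complex) \<Rightarrow> bool" where
  "is_jordan A f p q \<longleftrightarrow> pos_functional A p \<and> pos_functional A q \<and>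
     (\<forall>x\<in>vcar A. re_functional A f x = p x - q x) \<and>
     dual_nrm A (re_functional A f) = dual_nrm A p + dual_nrm A q"

definition natural_state :: "'a calg \<Rightarrow> ('a \<Rightarrow> complex) \<Rightarrow> 'a \<Rightarrow> complex" where
  "natural_state A f =
     (let (p, q) = (THE (p, q). is_jordan A f p q);
          s = (\<lambda>x\<in>vcar A. p x + q x)
      in (\<lambda>x\<in>vcar A. s x / complex_of_real (dual_nrm A s)))"

definition hnrm :: "'w hsp \<Rightarrow> 'w \<Rightarrow> real" where
  "hnrm H x = sqrt (Re (hinn H x x))"

text \<open>Inner products are linear in the second argument.\<close>

definition hilbert_space :: "'w hsp \<Rightarrow> bool" where
  "hilbert_space H \<longleftrightarrow>
     cvec_space H \<and>
     (\<forall>x\<in>vcar H. \<forall>y\<in>vcar H. hinn H x y = cnj (hinn H y x)) \<and>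
     (\<forall>x\<in>vcar H. \<forall>y\<in>vcar H. \<forall>z\<in>vcar H. hinn H x (vadd H y z) = hinn H x y + hinn H x z) \<and>
     (\<forall>a. \<forall>x\<in>vcar H. \<forall>y\<in>vcar H. hinn H x (vscl H a y) = a * hinn H x y) \<and>
     (\<forall>x\<in>vcar H. 0 \<le> Re (hinn H x x) \<and> (hinn H x x = 0 \<longleftrightarrow> x = vzero H)) \<and>
     ncomplete H (hnrm H)"

definition htop :: "'w hsp \<Rightarrow> 'w topology" where
  "htop H = ntop H (hnrm H)"

text \<open>The C*-algebra of bounded operators on \<open>H\<close>.\<close>

definition bdd_ops :: "'w hsp \<Rightarrow> ('w \<Rightarrow> 'w) set" where
  "bdd_ops H = {T \<in> linear_maps H H. \<exists>C. \<forall>x\<in>vcar H. hnrm H (T x) \<le> C * hnrm H x}"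

definition op_alg :: "'w hsp \<Rightarrow> ('w \<Rightarrow> 'w) calg" where
  "op_alg H =
     \<lparr>vcar = bdd_ops H,
      vzero = (\<lambda>x\<in>vcar H. vzero H),
      vadd = (\<lambda>S T. \<lambda>x\<in>vcar H. vadd H (S x) (T x)),
      vscl = (\<lambda>a T. \<lambda>x\<in>vcar H. vscl H a (T x)),
      amul = compose (vcar H),
      astar = (\<lambda>T. THE S. S \<in> bdd_ops H \<and>
        (\<forall>x\<in>vcar H. \<forall>y\<in>vcar H. hinn H (S x) y = hinn H x (T y))),
      anrm = (\<lambda>T. Sup {hnrm H (T x) | x. x \<in> vcar H \<and> hnrm H x \<le> 1})\<rparr>"

definition unitaries :: "'w hsp \<Rightarrow> 'w hsp \<Rightarrow> ('w \<Rightarrow> 'w) set" where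
  "unitaries H H' = {U \<in> linear_maps H H'. bij_betw U (vcar H) (vcar H') \<and>
     (\<forall>x\<in>vcar H. \<forall>y\<in>vcar H. hinn H' (U x) (U y) = hinn H x y)}"

text \<open>Normal states of \<open>\<L>(H)\<close>: order continuity along upward directed families with a supremum.\<close>

definition op_le :: "'w hsp \<Rightarrow> ('w \<Rightarrow> 'w) \<Rightarrow> ('w \<Rightarrow> 'w) \<Rightarrow> bool" where
  "op_le H S T \<longleftrightarrow> vsub (op_alg H) T S \<in> pos_cone (op_alg H)"

definition selfadj_ops :: "'w hsp \<Rightarrow> ('w \<Rightarrow> 'w) set" where
  "selfadj_ops H = {T \<in> bdd_ops H. astar (op_alg H) T = T}"

definition normal_state :: "'w hsp \<Rightarrow> (('w \<Rightarrow> 'w) \<Rightarrow> complex) \<Rightarrow> bool" where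
  "normal_state H \<phi> \<longleftrightarrow> is_state (op_alg H) \<phi> \<and>
     (\<forall>X T. X \<subseteq> selfadj_ops H \<and> X \<noteq> {} \<and>
        (\<forall>S1\<in>X. \<forall>S2\<in>X. \<exists>S3\<in>X. op_le H S1 S3 \<and> op_le H S2 S3) \<and>
        T \<in> selfadj_ops H \<and> (\<forall>S\<in>X. op_le H S T) \<and>
        (\<forall>T'\<in>selfadj_ops H. (\<forall>S\<in>X. op_le H S T') \<longrightarrow> op_le H T T')
        \<longrightarrow> Re (\<phi> T) = (SUP S\<in>X. Re (\<phi> S)))"

definition rep_normal :: "'a calg \<Rightarrow> 'w hsp \<Rightarrow> ('a \<Rightarrow> 'w \<Rightarrow> 'w) \<Rightarrow> ('a \<Rightarrow> complex) \<Rightarrow> bool" where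
  "rep_normal A H \<pi> \<omega> \<longleftrightarrow> is_state A \<omega> \<and>
     (\<exists>\<phi>. normal_state H \<phi> \<and> (\<forall>a\<in>vcar A. \<omega> a = \<phi> (\<pi> a)))"


section \<open>C*-dynamical systems, KMS states, GNS triples\<close>

definition cdyn_system ::
    "('k, 'z) monoid_scheme \<Rightarrow> 'k topology \<Rightarrow> 'a calg \<Rightarrow> ('k \<Rightarrow> 'a \<Rightarrow> 'a) \<Rightarrow> bool" where
  "cdyn_system K X A \<sigma> \<longleftrightarrow> unital_cstar_algebra A \<and>
     \<sigma> \<in> hom K (BijGroup (vcar A)) \<and>
     (\<forall>k\<in>carrier K. \<sigma> k \<in> star_homs A A) \<and>
     (\<forall>a\<in>vcar A. continuous_map X (ntop A (anrm A)) (\<lambda>k. \<sigma> k a))"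

text \<open>The entire extension of \<open>t \<mapsto> \<epsilon>(t) a\<close>, analyticity being tested on the dual.\<close>

definition entire_ext :: "'a calg \<Rightarrow> (real \<Rightarrow> 'a \<Rightarrow> 'a) \<Rightarrow> 'a \<Rightarrow> (complex \<Rightarrow> 'a) \<Rightarrow> bool" where
  "entire_ext A \<epsilon> a f \<longleftrightarrow> range f \<subseteq> vcar A \<and> (\<forall>t. f (complex_of_real t) = \<epsilon> t a) \<and>
     (\<forall>\<phi>\<in>dual A. (\<lambda>z. \<phi> (f z)) holomorphic_on UNIV)"

definition kms_state :: "'a calg \<Rightarrow> (real \<Rightarrow> 'a \<Rightarrow> 'a) \<Rightarrow> ('a \<Rightarrow> complex) \<Rightarrow> bool" where
  "kms_state A \<epsilon> \<omega> \<longleftrightarrow> is_state A \<omega> \<and>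
     (\<exists>\<A>. \<A> \<subseteq> vcar A \<and> vzero A \<in> \<A> \<and>
        (\<forall>a\<in>\<A>. \<forall>b\<in>\<A>. vadd A a b \<in> \<A> \<and> amul A a b \<in> \<A>) \<and>
        (\<forall>a\<in>\<A>. astar A a \<in> \<A> \<and> (\<forall>c. vscl A c a \<in> \<A>)) \<and>
        (\<forall>t. \<epsilon> t ` \<A> \<subseteq> \<A>) \<and>
        ntop A (anrm A) closure_of \<A> = vcar A \<and>
        (\<forall>b\<in>\<A>. \<exists>f. entire_ext A \<epsilon> b f) \<and>
        (\<forall>a\<in>\<A>. \<forall>b\<in>\<A>. \<omega> (amul A a ((THE f. entire_ext A \<epsilon> b f) (- \<i>))) = \<omega> (amul A b a)))"

definition gns_triple ::
    "'a calg \<Rightarrow> ('a \<Rightarrow> complex) \<Rightarrow> 'w hsp \<Rightarrow> ('a \<Rightarrow> 'w \<Rightarrow> 'w) \<Rightarrow> 'w \<Rightarrow> bool" where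
  "gns_triple A \<omega> H \<pi> \<Omega> \<longleftrightarrow> hilbert_space H \<and> \<pi> \<in> unital_star_homs A (op_alg H) \<and>
     \<Omega> \<in> vcar H \<and> hnrm H \<Omega> = 1 \<and>
     htop H closure_of ((\<lambda>a. \<pi> a \<Omega>) ` vcar A) = vcar H \<and>
     (\<forall>a\<in>vcar A. \<omega> a = hinn H \<Omega> (\<pi> a \<Omega>))"

definition gns_unitary ::
    "'a calg \<Rightarrow> ('k \<Rightarrow> 'a \<Rightarrow> 'a) \<Rightarrow> 'w hsp \<Rightarrow> ('a \<Rightarrow> 'w \<Rightarrow> 'w) \<Rightarrow> 'w \<Rightarrow> 'k \<Rightarrow> 'w \<Rightarrow> 'w" where
  "gns_unitary A \<sigma> H \<pi> \<Omega> s =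
     (THE U. U \<in> unitaries H H \<and> (\<forall>a\<in>vcar A. U (\<pi> a \<Omega>) = \<pi> (\<sigma> s a) \<Omega>))"

definition stab_F :: "('g, 'f) sd_data \<Rightarrow> 'a calg \<Rightarrow> ('g \<times> 'f \<Rightarrow> 'a \<Rightarrow> 'a) \<Rightarrow> ('a \<Rightarrow> complex) \<Rightarrow> 'f set" where
  "stab_F E A \<sigma> \<omega> = {h \<in> carrier (grpF E). \<forall>a\<in>vcar A. \<omega> (\<sigma> (j2 E h) a) = \<omega> a}"

definition stab_S ::
    "('g, 'f) sd_data \<Rightarrow> 'a calg \<Rightarrow> ('g \<times> 'f \<Rightarrow> 'a \<Rightarrow> 'a) \<Rightarrow> ('a \<Rightarrow> complex) \<Rightarrow> ('g \<times> 'f) set" where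
  "stab_S E A \<sigma> \<omega> = carrier (grpG E) \<times> stab_F E A \<sigma> \<omega>"

definition G_invariant_states ::
    "('g, 'f) sd_data \<Rightarrow> 'a calg \<Rightarrow> ('g \<times> 'f \<Rightarrow> 'a \<Rightarrow> 'a) \<Rightarrow> ('a \<Rightarrow> complex) set" where
  "G_invariant_states E A \<sigma> = {\<omega>. is_state A \<omega> \<and>
     (\<forall>g\<in>carrier (grpG E). \<forall>a\<in>vcar A. \<omega> (\<sigma> (j1 E g) a) = \<omega> a)}"


section \<open>Crossed products\<close>

text \<open>The integral of a compactly supported continuous \<open>A\<close>-valued function, and of
  \<open>\<pi>(f(s)) W(s)\<close>, are characterized weakly.\<close>

definition alg_integral :: "'k measure \<Rightarrow> 'a calg \<Rightarrow> ('k \<Rightarrow> 'a) \<Rightarrow> 'a" where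
  "alg_integral \<mu> A f = (THE a. a \<in> vcar A \<and> (\<forall>\<phi>\<in>dual A. \<phi> a = (LINT s|\<mu>. \<phi> (f s))))"

definition int_form ::
    "'k measure \<Rightarrow> 'w hsp \<Rightarrow> ('a \<Rightarrow> 'w \<Rightarrow> 'w) \<Rightarrow> ('k \<Rightarrow> 'w \<Rightarrow> 'w) \<Rightarrow> ('k \<Rightarrow> 'a) \<Rightarrow> 'w \<Rightarrow> 'w" where
  "int_form \<mu> H \<pi> W f = (THE T. T \<in> bdd_ops H \<and>
     (\<forall>x\<in>vcar H. \<forall>y\<in>vcar H. hinn H y (T x) = (LINT s|\<mu>. hinn H y (\<pi> (f s) (W s x)))))"

definition covariant_rep ::
    "('k, 'z) monoid_scheme \<Rightarrow> 'k topology \<Rightarrow> 'a calg \<Rightarrow> ('k \<Rightarrow> 'a \<Rightarrow> 'a) \<Rightarrow>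
     'w hsp \<Rightarrow> ('a \<Rightarrow> 'w \<Rightarrow> 'w) \<Rightarrow> ('k \<Rightarrow> 'w \<Rightarrow> 'w) \<Rightarrow> bool" where
  "covariant_rep K X A \<sigma> H \<pi> W \<longleftrightarrow> hilbert_space H \<and> \<pi> \<in> unital_star_homs A (op_alg H) \<and>
     (\<forall>s\<in>carrier K. W s \<in> unitaries H H) \<and>
     (\<forall>s\<in>carrier K. \<forall>t\<in>carrier K. W (s \<otimes>\<^bsub>K\<^esub> t) = compose (vcar H) (W s) (W t)) \<and>
     (\<forall>x\<in>vcar H. continuous_map X (htop H) (\<lambda>s. W s x)) \<and>
     (\<forall>s\<in>carrier K. \<forall>a\<in>vcar A.
        compose (vcar H) (W s) (\<pi> a) = compose (vcar H) (\<pi> (\<sigma> s a)) (W s))"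

definition Cc :: "('k, 'z) monoid_scheme \<Rightarrow> 'k topology \<Rightarrow> 'a calg \<Rightarrow> ('k \<Rightarrow> 'a) set" where
  "Cc K X A = {f \<in> extensional (carrier K). continuous_map X (ntop A (anrm A)) f \<and>
     (\<exists>C. compactin X C \<and> (\<forall>s\<in>carrier K - C. f s = vzero A))}"

text \<open>
  The *-algebra \<open>C\<^sub>c(K, A)\<close> with the universal norm. It suffices to let the covariant
  representations act on Hilbert spaces whose elements are functions on \<open>C\<^sub>c(K, A)\<close>: the norm
  is attained as a supremum over representations with a cyclic vector \<open>\<Omega>\<close>, and \<open>x\<close> can then be
  identified with the function that maps \<open>f\<close> to the inner product of \<open>(\<pi> \<rtimes> W)(f) \<Omega>\<close> with \<open>x\<close>.
\<close>

definition universal_norm ::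
    "('k, 'z) monoid_scheme \<Rightarrow> 'k topology \<Rightarrow> 'k measure \<Rightarrow> 'a calg \<Rightarrow> ('k \<Rightarrow> 'a \<Rightarrow> 'a) \<Rightarrow>
     ('k \<Rightarrow> 'a) \<Rightarrow> real" where
  "universal_norm K X \<mu> A \<sigma> f =
     Sup {anrm (op_alg H) (int_form \<mu> H \<pi> W f) | (H :: (('k \<Rightarrow> 'a) \<Rightarrow> complex) hsp) \<pi> W.
          covariant_rep K X A \<sigma> H \<pi> W}"

definition Cc_alg ::
    "('k, 'z) monoid_scheme \<Rightarrow> 'k topology \<Rightarrow> 'k measure \<Rightarrow> 'a calg \<Rightarrow> ('k \<Rightarrow> 'a \<Rightarrow> 'a) \<Rightarrow>
     ('k \<Rightarrow> 'a) calg" where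
  "Cc_alg K X \<mu> A \<sigma> =
     \<lparr>vcar = Cc K X A,
      vzero = (\<lambda>s\<in>carrier K. vzero A),
      vadd = (\<lambda>f g. \<lambda>s\<in>carrier K. vadd A (f s) (g s)),
      vscl = (\<lambda>c f. \<lambda>s\<in>carrier K. vscl A c (f s)),
      amul = (\<lambda>f g. \<lambda>s\<in>carrier K.
        alg_integral \<mu> A (\<lambda>r. amul A (f r) (\<sigma> r (g (inv\<^bsub>K\<^esub> r \<otimes>\<^bsub>K\<^esub> s))))),
      astar = (\<lambda>f. \<lambda>s\<in>carrier K.
        vscl A (complex_of_real (modular_fun K X \<mu> (inv\<^bsub>K\<^esub> s))) (\<sigma> s (astar A (f (inv\<^bsub>K\<^esub> s))))),
      anrm = universal_norm K X \<mu> A \<sigma>\<rparr>"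

text \<open>Completion of a normed *-algebra by classes of Cauchy sequences.\<close>

definition cauchy_seqs :: "'a calg \<Rightarrow> (nat \<Rightarrow> 'a) set" where
  "cauchy_seqs A = {s. range s \<subseteq> vcar A \<and>
     (\<forall>e>0. \<exists>M. \<forall>m\<ge>M. \<forall>n\<ge>M. anrm A (vsub A (s m) (s n)) < e)}"

definition cauchy_class :: "'a calg \<Rightarrow> (nat \<Rightarrow> 'a) \<Rightarrow> (nat \<Rightarrow> 'a) set" where
  "cauchy_class A s = {t \<in> cauchy_seqs A. (\<lambda>n. anrm A (vsub A (t n) (s n))) \<longlonglongrightarrow> 0}"

definition cembed :: "'a calg \<Rightarrow> 'a \<Rightarrow> (nat \<Rightarrow> 'a) set" where
  "cembed A x = cauchy_class A (\<lambda>n. x)"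

definition completion :: "'a calg \<Rightarrow> (nat \<Rightarrow> 'a) set calg" where
  "completion A =
     (let r = (\<lambda>P. SOME s. s \<in> P) in
     \<lparr>vcar = cauchy_class A ` cauchy_seqs A,
      vzero = cembed A (vzero A),
      vadd = (\<lambda>P Q. cauchy_class A (\<lambda>n. vadd A (r P n) (r Q n))),
      vscl = (\<lambda>c P. cauchy_class A (\<lambda>n. vscl A c (r P n))),
      amul = (\<lambda>P Q. cauchy_class A (\<lambda>n. amul A (r P n) (r Q n))),
      astar = (\<lambda>P. cauchy_class A (\<lambda>n. astar A (r P n))),
      anrm = (\<lambda>P. lim (\<lambda>n. anrm A (r P n)))\<rparr>)"

type_synonym ('k, 'a) cp = "(nat \<Rightarrow> 'k \<Rightarrow> 'a) set"

definition crossed_product ::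
    "('k, 'z) monoid_scheme \<Rightarrow> 'k topology \<Rightarrow> 'k measure \<Rightarrow> 'a calg \<Rightarrow> ('k \<Rightarrow> 'a \<Rightarrow> 'a) \<Rightarrow>
     ('k, 'a) cp calg" where
  "crossed_product K X \<mu> A \<sigma> = completion (Cc_alg K X \<mu> A \<sigma>)"

definition cp_embed ::
    "('k, 'z) monoid_scheme \<Rightarrow> 'k topology \<Rightarrow> 'k measure \<Rightarrow> 'a calg \<Rightarrow> ('k \<Rightarrow> 'a \<Rightarrow> 'a) \<Rightarrow>
     ('k \<Rightarrow> 'a) \<Rightarrow> ('k, 'a) cp" where
  "cp_embed K X \<mu> A \<sigma> = cembed (Cc_alg K X \<mu> A \<sigma>)"

text \<open>The representation \<open>\<pi> \<rtimes> W\<close> of the crossed product.\<close>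

definition cp_rep ::
    "('k, 'z) monoid_scheme \<Rightarrow> 'k topology \<Rightarrow> 'k measure \<Rightarrow> 'a calg \<Rightarrow> ('k \<Rightarrow> 'a \<Rightarrow> 'a) \<Rightarrow>
     'w hsp \<Rightarrow> ('a \<Rightarrow> 'w \<Rightarrow> 'w) \<Rightarrow> ('k \<Rightarrow> 'w \<Rightarrow> 'w) \<Rightarrow> ('k, 'a) cp \<Rightarrow> 'w \<Rightarrow> 'w" where
  "cp_rep K X \<mu> A \<sigma> H \<pi> W =
     (THE R. R \<in> star_homs (crossed_product K X \<mu> A \<sigma>) (op_alg H) \<and>
        (\<forall>f\<in>Cc K X A. R (cp_embed K X \<mu> A \<sigma> f) = int_form \<mu> H \<pi> W f))"


section \<open>Multiplier algebra and unitization\<close>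

text \<open>\<open>M(B)\<close> as the algebra of double centralizers \<open>(L, R)\<close>.\<close>

definition multiplier_alg :: "'b calg \<Rightarrow> (('b \<Rightarrow> 'b) \<times> ('b \<Rightarrow> 'b)) calg" where
  "multiplier_alg B =
     (let ad = (\<lambda>T. \<lambda>b\<in>vcar B. astar B (T (astar B b))) in
     \<lparr>vcar = {(L, R). L \<in> linear_maps B B \<and> R \<in> linear_maps B B \<and>
        (\<forall>a\<in>vcar B. \<forall>b\<in>vcar B. amul B a (L b) = amul B (R a) b)},
      vzero = (\<lambda>b\<in>vcar B. vzero B, \<lambda>b\<in>vcar B. vzero B),
      vadd = (\<lambda>(L1, R1) (L2, R2).
        (\<lambda>b\<in>vcar B. vadd B (L1 b) (L2 b), \<lambda>b\<in>vcar B. vadd B (R1 b) (R2 b))),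
      vscl = (\<lambda>c (L, R). (\<lambda>b\<in>vcar B. vscl B c (L b), \<lambda>b\<in>vcar B. vscl B c (R b))),
      amul = (\<lambda>(L1, R1) (L2, R2). (compose (vcar B) L1 L2, compose (vcar B) R2 R1)),
      astar = (\<lambda>(L, R). (ad R, ad L)),
      anrm = (\<lambda>(L, R). Sup {anrm B (L b) | b. b \<in> vcar B \<and> anrm B b \<le> 1})\<rparr>)"

definition mult_embed :: "'b calg \<Rightarrow> 'b \<Rightarrow> ('b \<Rightarrow> 'b) \<times> ('b \<Rightarrow> 'b)" where
  "mult_embed B = (\<lambda>b\<in>vcar B. (\<lambda>x\<in>vcar B. amul B b x, \<lambda>x\<in>vcar B. amul B x b))"

text \<open>The extensions \<open>\<alpha>\<^sup>-\<close> of a nondegenerate \<open>\<alpha> : B \<rightarrow> M(C)\<close> and \<open>\<psi>\<^sup>-\<close> of a state \<open>\<psi>\<close> of \<open>B\<close>.\<close>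

definition mult_ext ::
    "'b calg \<Rightarrow> 'c calg \<Rightarrow> ('b \<Rightarrow> ('c \<Rightarrow> 'c) \<times> ('c \<Rightarrow> 'c)) \<Rightarrow>
     ('b \<Rightarrow> 'b) \<times> ('b \<Rightarrow> 'b) \<Rightarrow> ('c \<Rightarrow> 'c) \<times> ('c \<Rightarrow> 'c)" where
  "mult_ext B C \<alpha> = (THE \<beta>. \<beta> \<in> star_homs (multiplier_alg B) (multiplier_alg C) \<and>
     (\<forall>b\<in>vcar B. \<beta> (mult_embed B b) = \<alpha> b))"

definition state_ext ::
    "'b calg \<Rightarrow> ('b \<Rightarrow> complex) \<Rightarrow> ('b \<Rightarrow> 'b) \<times> ('b \<Rightarrow> 'b) \<Rightarrow> complex" where
  "state_ext B \<psi> = (THE \<theta>. is_state (multiplier_alg B) \<theta> \<and>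
     (\<forall>b\<in>vcar B. \<theta> (mult_embed B b) = \<psi> b))"

text \<open>The map \<open>j : A \<rightarrow> M(A \<rtimes> K)\<close>.\<close>

definition cp_mult ::
    "('k, 'z) monoid_scheme \<Rightarrow> 'k topology \<Rightarrow> 'k measure \<Rightarrow> 'a calg \<Rightarrow> ('k \<Rightarrow> 'a \<Rightarrow> 'a) \<Rightarrow> 'a \<Rightarrow>
     (('k, 'a) cp \<Rightarrow> ('k, 'a) cp) \<times> (('k, 'a) cp \<Rightarrow> ('k, 'a) cp)" where
  "cp_mult K X \<mu> A \<sigma> a =
     (THE m. m \<in> vcar (multiplier_alg (crossed_product K X \<mu> A \<sigma>)) \<and>
        (\<forall>f\<in>Cc K X A. fst m (cp_embed K X \<mu> A \<sigma> f) =
           cp_embed K X \<mu> A \<sigma> (\<lambda>s\<in>carrier K. amul A a (f s))))"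

text \<open>The norm of the unitization \<open>B\<^sup>+\<close> is the one inherited from \<open>M(B) \<oplus> \<complex>\<close>; it is the C*-norm
  whether or not \<open>B\<close> has a unit.\<close>

definition unitization :: "'b calg \<Rightarrow> ('b \<times> complex) calg" where
  "unitization B =
     \<lparr>vcar = vcar B \<times> UNIV,
      vzero = (vzero B, 0),
      vadd = (\<lambda>(b, s) (c, t). (vadd B b c, s + t)),
      vscl = (\<lambda>z (b, s). (vscl B z b, z * s)),
      amul = (\<lambda>(b, s) (c, t). (vadd B (amul B b c) (vadd B (vscl B t b) (vscl B s c)), s * t)),
      astar = (\<lambda>(b, s). (astar B b, cnj s)),
      anrm = (\<lambda>(b, s). max (cmod s)
        (Sup {anrm B (vadd B (amul B b c) (vscl B s c)) | c. c \<in> vcar B \<and> anrm B c \<le> 1}))\<rparr>"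

definition plus_hom :: "'b calg \<Rightarrow> ('b \<Rightarrow> 'c) \<Rightarrow> 'b \<times> complex \<Rightarrow> 'c \<times> complex" where
  "plus_hom B \<alpha> = (\<lambda>(b, s)\<in>vcar (unitization B). (\<alpha> b, s))"

definition plus_rep :: "'b calg \<Rightarrow> 'w hsp \<Rightarrow> ('b \<Rightarrow> 'w \<Rightarrow> 'w) \<Rightarrow> 'b \<times> complex \<Rightarrow> 'w \<Rightarrow> 'w" where
  "plus_rep B H R = (\<lambda>(b, s)\<in>vcar (unitization B).
     vadd (op_alg H) (R b) (vscl (op_alg H) s (\<lambda>x\<in>vcar H. x)))"


section \<open>The group \<open>K\<^sub>0\<close> of a unital C*-algebra\<close>

text \<open>A matrix is a function of two indices, zero outside its format.\<close>

type_synonym 'c mat = "nat \<Rightarrow> nat \<Rightarrow> 'c"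

definition mats :: "'c calg \<Rightarrow> nat \<Rightarrow> nat \<Rightarrow> 'c mat set" where
  "mats C m n = {P. \<forall>i j. if i < m \<and> j < n then P i j \<in> vcar C else P i j = vzero C}"

definition mat_mul :: "'c calg \<Rightarrow> nat \<Rightarrow> 'c mat \<Rightarrow> 'c mat \<Rightarrow> 'c mat" where
  "mat_mul C k P Q = (\<lambda>i j. vsum C (\<lambda>r. amul C (P i r) (Q r j)) k)"

definition mat_star :: "'c calg \<Rightarrow> 'c mat \<Rightarrow> 'c mat" where
  "mat_star C P = (\<lambda>i j. astar C (P j i))"

definition projections :: "'c calg \<Rightarrow> (nat \<times> 'c mat) set" where
  "projections C = {(n, P). P \<in> mats C n n \<and> mat_star C P = P \<and> mat_mul C n P P = P}"

definition mvn_equiv :: "'c calg \<Rightarrow> nat \<times> 'c mat \<Rightarrow> nat \<times> 'c mat \<Rightarrow> bool" where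
  "mvn_equiv C p q \<longleftrightarrow> (\<exists>V\<in>mats C (fst q) (fst p).
     mat_mul C (fst q) (mat_star C V) V = snd p \<and> mat_mul C (fst p) V (mat_star C V) = snd q)"

definition dsum :: "'c calg \<Rightarrow> nat \<times> 'c mat \<Rightarrow> nat \<times> 'c mat \<Rightarrow> nat \<times> 'c mat" where
  "dsum C p q = (fst p + fst q, \<lambda>i j.
     if i < fst p \<and> j < fst p then snd p i j
     else if fst p \<le> i \<and> fst p \<le> j then snd q (i - fst p) (j - fst p)
     else vzero C)"

text \<open>An element of \<open>K\<^sub>0(C)\<close> is the set of all pairs \<open>(p, q)\<close> with the same formal difference
  \<open>[p] - [q]\<close>.\<close>

type_synonym 'c k0 = "((nat \<times> 'c mat) \<times> (nat \<times> 'c mat)) set"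

definition k0_class :: "'c calg \<Rightarrow> nat \<times> 'c mat \<Rightarrow> nat \<times> 'c mat \<Rightarrow> 'c k0" where
  "k0_class C p q = {(p', q'). p' \<in> projections C \<and> q' \<in> projections C \<and>
     (\<exists>r\<in>projections C. mvn_equiv C (dsum C (dsum C p q') r) (dsum C (dsum C p' q) r))}"

definition K0 :: "'c calg \<Rightarrow> 'c k0 monoid" where
  "K0 C =
     \<lparr>carrier = {k0_class C p q | p q. p \<in> projections C \<and> q \<in> projections C},
      mult = (\<lambda>x y. THE z. \<exists>(p, q)\<in>x. \<exists>(p', q')\<in>y. z = k0_class C (dsum C p p') (dsum C q q')),
      one = k0_class C (0, \<lambda>i j. vzero C) (0, \<lambda>i j. vzero C)\<rparr>"

definition K0_map :: "'c calg \<Rightarrow> 'd calg \<Rightarrow> ('c \<Rightarrow> 'd) \<Rightarrow> 'c k0 \<Rightarrow> 'd k0" where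
  "K0_map C C' h =
     (let hm = (\<lambda>p. (fst p, \<lambda>i j. if i < fst p \<and> j < fst p then h (snd p i j) else vzero C')) in
     (\<lambda>x\<in>carrier (K0 C). THE y. \<exists>(p, q)\<in>x. y = k0_class C' (hm p) (hm q)))"


section \<open>Entire cyclic cohomology\<close>

text \<open>
  A cochain is a function on nonempty lists over the carrier; its \<open>n\<close>-dimensional component is
  its restriction to the lists of length \<open>n + 1\<close>. We use Connes' \<open>(b, B)\<close> bicomplex with the
  cocycle condition \<open>b \<phi> + B \<phi> = 0\<close>.
\<close>

definition multilinear :: "'c calg \<Rightarrow> ('c list \<Rightarrow> complex) \<Rightarrow> bool" where
  "multilinear C \<phi> \<longleftrightarrow>
     (\<forall>xs i. xs \<in> lists (vcar C) \<and> i < length xs \<longrightarrow>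
        (\<forall>x\<in>vcar C. \<forall>y\<in>vcar C. \<phi> (xs[i := vadd C x y]) = \<phi> (xs[i := x]) + \<phi> (xs[i := y])) \<and>
        (\<forall>a. \<forall>x\<in>vcar C. \<phi> (xs[i := vscl C a x]) = a * \<phi> (xs[i := x])))"

definition cochain_vals :: "'c calg \<Rightarrow> ('c list \<Rightarrow> complex) \<Rightarrow> nat \<Rightarrow> real set" where
  "cochain_vals C \<phi> n =
     {cmod (\<phi> xs) | xs. length xs = n + 1 \<and> (\<forall>x\<in>set xs. x \<in> vcar C \<and> anrm C x \<le> 1)}"

text \<open>For even cochains the growth condition is
  \<open>\<Sum>\<^sub>k (2k)!/k! \<parallel>\<phi>\<^sub>2\<^sub>k\<parallel> r\<^sup>k < \<infinity>\<close> for all \<open>r\<close>, for odd ones it is \<open>\<Sum>\<^sub>k (2k+1)!/k! \<parallel>\<phi>\<^sub>2\<^sub>k\<^sub>+\<^sub>1\<parallel> r\<^sup>k < \<infinity>\<close>.\<close>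

definition entire_cochain :: "'c calg \<Rightarrow> ('c list \<Rightarrow> complex) \<Rightarrow> bool" where
  "entire_cochain C \<phi> \<longleftrightarrow>
     (\<forall>xs. xs = [] \<or> xs \<notin> lists (vcar C) \<longrightarrow> \<phi> xs = 0) \<and>
     multilinear C \<phi> \<and> (\<forall>n. bdd_above (cochain_vals C \<phi> n)) \<and>
     (\<forall>r>0. summable (\<lambda>n. fact n / fact (n div 2) * Sup (cochain_vals C \<phi> n) * r ^ (n div 2)))"

definition even_cochain :: "('c list \<Rightarrow> complex) \<Rightarrow> bool" where
  "even_cochain \<phi> \<longleftrightarrow> (\<forall>xs. even (length xs) \<longrightarrow> \<phi> xs = 0)"

definition odd_cochain :: "('c list \<Rightarrow> complex) \<Rightarrow> bool" where
  "odd_cochain \<phi> \<longleftrightarrow> (\<forall>xs. odd (length xs) \<longrightarrow> \<phi> xs = 0)"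

definition hochschild_b :: "'c calg \<Rightarrow> ('c list \<Rightarrow> complex) \<Rightarrow> 'c list \<Rightarrow> complex" where
  "hochschild_b C \<phi> xs = (if length xs < 2 then 0 else
     (\<Sum>j<length xs - 1. (-1) ^ j *
        \<phi> (take j xs @ [amul C (xs ! j) (xs ! (j + 1))] @ drop (j + 2) xs)) +
     (-1) ^ (length xs - 1) * \<phi> (amul C (last xs) (hd xs) # butlast (tl xs)))"

definition connes_B0 :: "'c calg \<Rightarrow> ('c list \<Rightarrow> complex) \<Rightarrow> 'c list \<Rightarrow> complex" where
  "connes_B0 C \<phi> xs = \<phi> (aunit C # xs) - (-1) ^ length xs * \<phi> (xs @ [aunit C])"

definition cyclic_A :: "('c list \<Rightarrow> complex) \<Rightarrow> 'c list \<Rightarrow> complex" where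
  "cyclic_A \<phi> xs = (\<Sum>j<length xs. (-1) ^ (j * (length xs - 1)) * \<phi> (rotate j xs))"

definition bB :: "'c calg \<Rightarrow> ('c list \<Rightarrow> complex) \<Rightarrow> 'c list \<Rightarrow> complex" where
  "bB C \<phi> xs = (if xs = [] \<or> xs \<notin> lists (vcar C) then 0
     else hochschild_b C \<phi> xs + cyclic_A (connes_B0 C \<phi>) xs)"

definition even_entire_cocycle :: "'c calg \<Rightarrow> ('c list \<Rightarrow> complex) \<Rightarrow> bool" where
  "even_entire_cocycle C \<phi> \<longleftrightarrow> entire_cochain C \<phi> \<and> even_cochain \<phi> \<and> (\<forall>xs. bB C \<phi> xs = 0)"

text \<open>Connes' normalization: \<open>B\<^sub>0 \<phi>\<^sub>m = (1/m) A B\<^sub>0 \<phi>\<^sub>m\<close>, that is, \<open>B\<^sub>0 \<phi>\<close> is cyclic.\<close>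

definition normalized_cocycle :: "'c calg \<Rightarrow> ('c list \<Rightarrow> complex) \<Rightarrow> bool" where
  "normalized_cocycle C \<phi> \<longleftrightarrow> (\<forall>xs\<in>lists (vcar C). xs \<noteq> [] \<longrightarrow>
     of_nat (length xs) * connes_B0 C \<phi> xs = cyclic_A (connes_B0 C \<phi>) xs)"

definition ecc_class :: "'c calg \<Rightarrow> ('c list \<Rightarrow> complex) \<Rightarrow> ('c list \<Rightarrow> complex) set" where
  "ecc_class C \<phi> = {\<psi>. even_entire_cocycle C \<psi> \<and>
     (\<exists>\<theta>. entire_cochain C \<theta> \<and> odd_cochain \<theta> \<and> (\<forall>xs. \<psi> xs - \<phi> xs = bB C \<theta> xs))}"

text \<open>The value \<open>\<Sum>\<^sub>k (-1)\<^sup>k (2k)!/k! (\<phi>\<^sub>2\<^sub>k # Tr)(p, \<dots>, p)\<close> on a projection \<open>p\<close> in a matrix algebra.\<close>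

definition cocycle_on_proj :: "('c list \<Rightarrow> complex) \<Rightarrow> nat \<times> 'c mat \<Rightarrow> complex" where
  "cocycle_on_proj \<phi> p = (\<Sum>k. (-1) ^ k * (fact (2 * k) / fact k) *
     (\<Sum>is\<in>{is. length is = 2 * k + 1 \<and> set is \<subseteq> {..<fst p}}.
        \<phi> (map (\<lambda>j. snd p (is ! j) (is ! (Suc j mod (2 * k + 1)))) [0..<2 * k + 1])))"

text \<open>Connes' pairing, evaluated on a normalized representative of the class.\<close>

definition connes_pairing :: "'c k0 \<Rightarrow> 'c calg \<Rightarrow> ('c list \<Rightarrow> complex) set \<Rightarrow> complex" where
  "connes_pairing x C c = (THE z. \<exists>\<psi>\<in>c. normalized_cocycle C \<psi> \<and>
     (\<exists>(p, q)\<in>x. z = cocycle_on_proj \<psi> p - cocycle_on_proj \<psi> q))"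


section \<open>Even theta-summable K-cycles and the JLO cocycle\<close>

text \<open>An unbounded operator is a pair of its domain and a map extensional on the domain.\<close>

type_synonym 'w unb = "'w set \<times> ('w \<Rightarrow> 'w)"

definition selfadjoint_unb :: "'w hsp \<Rightarrow> 'w unb \<Rightarrow> bool" where
  "selfadjoint_unb H D \<longleftrightarrow>
     fst D \<subseteq> vcar H \<and> vzero H \<in> fst D \<and>
     (\<forall>x\<in>fst D. \<forall>y\<in>fst D. vadd H x y \<in> fst D \<and> snd D (vadd H x y) = vadd H (snd D x) (snd D y)) \<and>
     (\<forall>a. \<forall>x\<in>fst D. vscl H a x \<in> fst D \<and> snd D (vscl H a x) = vscl H a (snd D x)) \<and>
     snd D \<in> fst D \<rightarrow>\<^sub>E vcar H \<and>
     htop H closure_of fst D = vcar H \<and>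
     fst D = {y \<in> vcar H. \<exists>z\<in>vcar H. \<forall>x\<in>fst D. hinn H y (snd D x) = hinn H z x} \<and>
     (\<forall>x\<in>fst D. \<forall>y\<in>fst D. hinn H y (snd D x) = hinn H (snd D y) x)"

definition compact_op :: "'w hsp \<Rightarrow> ('w \<Rightarrow> 'w) \<Rightarrow> bool" where
  "compact_op H T \<longleftrightarrow> T \<in> bdd_ops H \<and>
     compactin (htop H) (htop H closure_of (T ` {x \<in> vcar H. hnrm H x \<le> 1}))"

text \<open>The resolvent at \<open>- \<i>\<close> is compact.\<close>

definition compact_resolvent :: "'w hsp \<Rightarrow> 'w unb \<Rightarrow> bool" where
  "compact_resolvent H D \<longleftrightarrow> (\<exists>T. compact_op H T \<and>
     (\<forall>x\<in>vcar H. T x \<in> fst D \<and> vadd H (snd D (T x)) (vscl H \<i> (T x)) = x))"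

text \<open>\<open>exp(-t D\<^sup>2)\<close>; the eigenvectors of an operator with compact resolvent span a dense subspace.\<close>

definition heat_op :: "'w hsp \<Rightarrow> 'w unb \<Rightarrow> real \<Rightarrow> 'w \<Rightarrow> 'w" where
  "heat_op H D t = (THE T. T \<in> bdd_ops H \<and>
     (\<forall>x\<in>fst D. \<forall>l::real. snd D x = vscl H (complex_of_real l) x \<longrightarrow>
        T x = vscl H (complex_of_real (exp (- t * l\<^sup>2))) x))"

definition is_onb :: "'w hsp \<Rightarrow> 'w set \<Rightarrow> bool" where
  "is_onb H B \<longleftrightarrow> B \<subseteq> vcar H \<and>
     (\<forall>x\<in>B. \<forall>y\<in>B. hinn H x y = (if x = y then 1 else 0)) \<and>
     (\<forall>x\<in>vcar H. (\<forall>e\<in>B. hinn H e x = 0) \<longrightarrow> x = vzero H)"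

definition op_trace :: "'w hsp \<Rightarrow> ('w \<Rightarrow> 'w) \<Rightarrow> complex" where
  "op_trace H T = infsum (\<lambda>e. hinn H e (T e)) (SOME B. is_onb H B)"

definition bounded_commutator :: "'w hsp \<Rightarrow> 'w unb \<Rightarrow> ('w \<Rightarrow> 'w) \<Rightarrow> bool" where
  "bounded_commutator H D T \<longleftrightarrow> T ` fst D \<subseteq> fst D \<and>
     (\<exists>C. \<forall>x\<in>fst D. hnrm H (vsub H (snd D (T x)) (T (snd D x))) \<le> C * hnrm H x)"

definition commutator :: "'w hsp \<Rightarrow> 'w unb \<Rightarrow> ('w \<Rightarrow> 'w) \<Rightarrow> 'w \<Rightarrow> 'w" where
  "commutator H D T = (THE S. S \<in> bdd_ops H \<and>
     (\<forall>x\<in>fst D. S x = vsub H (snd D (T x)) (T (snd D x))))"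

definition even_theta_K_cycle ::
    "'c calg \<Rightarrow> 'w hsp \<Rightarrow> ('c \<Rightarrow> 'w \<Rightarrow> 'w) \<Rightarrow> 'w unb \<Rightarrow> ('w \<Rightarrow> 'w) \<Rightarrow> bool" where
  "even_theta_K_cycle C H \<pi> D \<Gamma> \<longleftrightarrow>
     hilbert_space H \<and> \<pi> \<in> unital_star_homs C (op_alg H) \<and>
     selfadjoint_unb H D \<and> (\<exists>x\<in>fst D. snd D x \<noteq> vzero H) \<and> compact_resolvent H D \<and>
     (\<forall>a\<in>vcar C. bounded_commutator H D (\<pi> a)) \<and>
     (\<exists>B. is_onb H B \<and> (\<lambda>e. hinn H e (heat_op H D 1 e)) summable_on B) \<and>
     \<Gamma> \<in> unitaries H H \<and> \<Gamma> \<in> selfadj_ops H \<and>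
     (\<forall>a\<in>vcar C. compose (vcar H) \<Gamma> (\<pi> a) = compose (vcar H) (\<pi> a) \<Gamma>) \<and>
     \<Gamma> ` fst D = fst D \<and> (\<forall>x\<in>fst D. \<Gamma> (snd D (\<Gamma> x)) = vscl H (-1) (snd D x))"

text \<open>The operator \<open>[D, \<pi>(a\<^sub>k)] exp(-s\<^sub>k D\<^sup>2) [D, \<pi>(a\<^sub>k\<^sub>+\<^sub>1)] exp(-s\<^sub>k\<^sub>+\<^sub>1 D\<^sup>2) \<dots>\<close>.\<close>

primrec jlo_prod ::
    "'w hsp \<Rightarrow> ('c \<Rightarrow> 'w \<Rightarrow> 'w) \<Rightarrow> 'w unb \<Rightarrow> (nat \<Rightarrow> real) \<Rightarrow> nat \<Rightarrow> 'c list \<Rightarrow> 'w \<Rightarrow> 'w" where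
  "jlo_prod H \<pi> D s k [] = (\<lambda>x\<in>vcar H. x)"
| "jlo_prod H \<pi> D s k (a # as) =
     compose (vcar H) (commutator H D (\<pi> a))
       (compose (vcar H) (heat_op H D (s k)) (jlo_prod H \<pi> D s (Suc k) as))"

definition jlo_cocycle ::
    "'c calg \<Rightarrow> 'w hsp \<Rightarrow> ('c \<Rightarrow> 'w \<Rightarrow> 'w) \<Rightarrow> 'w unb \<Rightarrow> ('w \<Rightarrow> 'w) \<Rightarrow> 'c list \<Rightarrow> complex" where
  "jlo_cocycle C H \<pi> D \<Gamma> as =
     (if even (length as) \<or> as \<notin> lists (vcar C) then 0 else
      (let n = length as - 1;
           \<Delta> = {s \<in> {1..n} \<rightarrow>\<^sub>E {0..}. (\<Sum>i=1..n. s i) \<le> 1}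
       in set_lebesgue_integral (Pi\<^sub>M {1..n} (\<lambda>_. lborel)) \<Delta>
            (\<lambda>s. op_trace H (compose (vcar H) \<Gamma> (compose (vcar H) (\<pi> (hd as))
               (compose (vcar H) (heat_op H D (1 - (\<Sum>i=1..n. s i))) (jlo_prod H \<pi> D s 1 (tl as))))))))"

definition chern_character ::
    "'c calg \<Rightarrow> 'w hsp \<Rightarrow> ('c \<Rightarrow> 'w \<Rightarrow> 'w) \<Rightarrow> 'w unb \<Rightarrow> ('w \<Rightarrow> 'w) \<Rightarrow> ('c list \<Rightarrow> complex) set" where
  "chern_character C H \<pi> D \<Gamma> = ecc_class C (jlo_cocycle C H \<pi> D \<Gamma>)"


section \<open>Categories and set-valued functors\<close>

record ('o, 'm) cat =
  Obj :: "'o set"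
  Mor :: "'m set"
  dom :: "'m \<Rightarrow> 'o"
  cod :: "'m \<Rightarrow> 'o"
  idm :: "'o \<Rightarrow> 'm"
  cmp :: "'m \<Rightarrow> 'm \<Rightarrow> 'm"

definition category :: "('o, 'm) cat \<Rightarrow> bool" where
  "category C \<longleftrightarrow>
     (\<forall>t\<in>Mor C. dom C t \<in> Obj C \<and> cod C t \<in> Obj C) \<and>
     (\<forall>a\<in>Obj C. idm C a \<in> Mor C \<and> dom C (idm C a) = a \<and> cod C (idm C a) = a) \<and>
     (\<forall>t\<in>Mor C. \<forall>s\<in>Mor C. cod C s = dom C t \<longrightarrow>
        cmp C t s \<in> Mor C \<and> dom C (cmp C t s) = dom C s \<and> cod C (cmp C t s) = cod C t) \<and>
     (\<forall>t\<in>Mor C. cmp C t (idm C (dom C t)) = t \<and> cmp C (idm C (cod C t)) t = t) \<and>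
     (\<forall>t\<in>Mor C. \<forall>s\<in>Mor C. \<forall>r\<in>Mor C. cod C s = dom C t \<and> cod C r = dom C s \<longrightarrow>
        cmp C (cmp C t s) r = cmp C t (cmp C s r))"

record ('o1, 'm1, 'o2, 'm2) fct =
  fobj :: "'o1 \<Rightarrow> 'o2"
  fmor :: "'m1 \<Rightarrow> 'm2"

definition is_functor :: "('o1, 'm1) cat \<Rightarrow> ('o2, 'm2) cat \<Rightarrow> ('o1, 'm1, 'o2, 'm2) fct \<Rightarrow> bool" where
  "is_functor C C' \<F> \<longleftrightarrow>
     (\<forall>a\<in>Obj C. fobj \<F> a \<in> Obj C' \<and> fmor \<F> (idm C a) = idm C' (fobj \<F> a)) \<and>
     (\<forall>t\<in>Mor C. fmor \<F> t \<in> Mor C' \<and> dom C' (fmor \<F> t) = fobj \<F> (dom C t) \<and>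
        cod C' (fmor \<F> t) = fobj \<F> (cod C t)) \<and>
     (\<forall>t\<in>Mor C. \<forall>s\<in>Mor C. cod C s = dom C t \<longrightarrow>
        fmor \<F> (cmp C t s) = cmp C' (fmor \<F> t) (fmor \<F> s))"

text \<open>Functors \<open>C\<^sup>o\<^sup>p \<rightarrow> set\<close> and their morphisms; only the values of the maps on the sets
  \<open>P(a)\<close> matter.\<close>

record ('o, 'm, 'x) psh =
  pobj :: "'o \<Rightarrow> 'x set"
  pmap :: "'m \<Rightarrow> 'x \<Rightarrow> 'x"

definition presheaf :: "('o, 'm) cat \<Rightarrow> ('o, 'm, 'x) psh \<Rightarrow> bool" where
  "presheaf C P \<longleftrightarrow>
     (\<forall>t\<in>Mor C. pmap P t \<in> pobj P (cod C t) \<rightarrow> pobj P (dom C t)) \<and>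
     (\<forall>a\<in>Obj C. \<forall>x\<in>pobj P a. pmap P (idm C a) x = x) \<and>
     (\<forall>t\<in>Mor C. \<forall>s\<in>Mor C. cod C s = dom C t \<longrightarrow>
        (\<forall>x\<in>pobj P (cod C t). pmap P (cmp C t s) x = pmap P s (pmap P t x)))"

definition natural :: "('o, 'm) cat \<Rightarrow> ('o, 'm, 'x) psh \<Rightarrow> ('o, 'm, 'y) psh \<Rightarrow> ('o \<Rightarrow> 'x \<Rightarrow> 'y) \<Rightarrow> bool" where
  "natural C P R \<xi> \<longleftrightarrow>
     (\<forall>a\<in>Obj C. \<xi> a \<in> pobj P a \<rightarrow> pobj R a) \<and>
     (\<forall>t\<in>Mor C. \<forall>x\<in>pobj P (cod C t). \<xi> (dom C t) (pmap P t x) = pmap R t (\<xi> (cod C t) x))"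

definition presheaf_mor ::
    "('o, 'm) cat \<Rightarrow> ('o, 'm, 'x) psh \<Rightarrow> ('o, 'm, 'y) psh \<Rightarrow> ('o \<Rightarrow> 'x \<Rightarrow> 'y) set" where
  "presheaf_mor C P R = {\<xi>. presheaf C P \<and> presheaf C R \<and> natural C P R \<xi>}"

text \<open>Equivariant maps, and morphisms of sets with a group action.\<close>

definition equivariant ::
    "('k, 'z) monoid_scheme \<Rightarrow> 'x set \<Rightarrow> ('k \<Rightarrow> 'x \<Rightarrow> 'x) \<Rightarrow> 'y set \<Rightarrow> ('k \<Rightarrow> 'y \<Rightarrow> 'y) \<Rightarrow>
     ('x \<Rightarrow> 'y) \<Rightarrow> bool" where
  "equivariant K X \<tau> Y \<tau>' \<xi> \<longleftrightarrow> \<xi> \<in> X \<rightarrow> Y \<and> (\<forall>l\<in>carrier K. \<forall>x\<in>X. \<xi> (\<tau> l x) = \<tau>' l (\<xi> x))"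

definition is_Kset :: "('k, 'z) monoid_scheme \<Rightarrow> 'x set \<Rightarrow> ('k \<Rightarrow> 'x \<Rightarrow> 'x) \<Rightarrow> bool" where
  "is_Kset K X \<tau> \<longleftrightarrow> group_action K X (\<lambda>l. restrict (\<tau> l) X)"

definition Kset_mor ::
    "('k, 'z) monoid_scheme \<Rightarrow> 'x set \<Rightarrow> ('k \<Rightarrow> 'x \<Rightarrow> 'x) \<Rightarrow> 'y set \<Rightarrow> ('k \<Rightarrow> 'y \<Rightarrow> 'y) \<Rightarrow>
     ('x \<Rightarrow> 'y) set" where
  "Kset_mor K X \<tau> Y \<tau>' = {\<xi>. is_Kset K X \<tau> \<and> is_Kset K Y \<tau>' \<and> equivariant K X \<tau> Y \<tau>' \<xi>}"


section \<open>The category \<open>\<GG>(G, F, \<rho>)\<close>\<close>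

text \<open>Indices are arbitrary elements some of which are real numbers: the real number \<open>x\<close> is
  \<^term>\<open>Inl x\<close>.\<close>

type_synonym 'i idx = "real + 'i"

record ('g, 'f, 'q, 'i, 'v, 'w, 'n) gobj =
  oT :: "'q set"
  oI :: "'q \<Rightarrow> 'i idx set"
  obeta :: "'q \<Rightarrow> 'i idx"
  oP :: "'q \<Rightarrow> 'i idx set"
  oA :: "'q \<Rightarrow> 'i idx \<Rightarrow> 'v calg"
  oeta :: "'q \<Rightarrow> 'i idx \<Rightarrow> 'g \<times> 'f \<Rightarrow> 'v \<Rightarrow> 'v"
  oeps :: "'q \<Rightarrow> 'i idx \<Rightarrow> real \<Rightarrow> 'v \<Rightarrow> 'v"
  ophi :: "'q \<Rightarrow> 'i idx \<Rightarrow> 'v \<Rightarrow> complex"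
  oAb :: "'n monoid"
  opsi :: "'g \<times> 'f \<Rightarrow> 'n \<Rightarrow> 'n"
  ob :: "'g \<times> 'f \<Rightarrow> 'q \<Rightarrow> 'q"
  om :: "'n \<Rightarrow> 'q \<Rightarrow> 'i idx \<Rightarrow> real"
  omu :: "'q \<Rightarrow> 'i idx \<Rightarrow> ('g \<times> 'f) measure"
  ou :: "'q \<Rightarrow> 'i idx \<Rightarrow> 'n \<Rightarrow> (('g \<times> 'f, 'v) cp \<times> complex) k0"
  oH :: "'q \<Rightarrow> 'i idx \<Rightarrow> 'w hsp"
  opi :: "'q \<Rightarrow> 'i idx \<Rightarrow> 'v \<Rightarrow> 'w \<Rightarrow> 'w"
  oOm :: "'q \<Rightarrow> 'i idx \<Rightarrow> 'w"
  oD :: "'q \<Rightarrow> 'i idx \<Rightarrow> 'w unb"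
  oGam :: "'q \<Rightarrow> 'i idx \<Rightarrow> 'w \<Rightarrow> 'w"
  ov :: "'q \<Rightarrow> 'i idx \<Rightarrow> 'g \<times> 'f \<Rightarrow> 'w \<Rightarrow> 'w"
  ow :: "'q \<Rightarrow> 'i idx \<Rightarrow> 'g \<times> 'f \<Rightarrow> ('g \<times> 'f, 'v) cp \<Rightarrow> ('g \<times> 'f, 'v) cp"
  oz :: "'q \<Rightarrow> 'i idx \<Rightarrow> 'g \<times> 'f \<Rightarrow> 'v \<Rightarrow> 'v"

text \<open>The subgroup \<open>S\<close> of \<open>H\<close> and its topology, for the state \<open>\<phi>\<close> with indices \<open>Q, \<alpha>\<close>; the
  crossed product with respect to a Haar measure \<open>\<nu>\<close>, and the associated maps.\<close>

definition oF :: "('g, 'f) sd_data \<Rightarrow> ('g, 'f, 'q, 'i, 'v, 'w, 'n) gobj \<Rightarrow> 'q \<Rightarrow> 'i idx \<Rightarrow> 'f set" where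
  "oF E N Q \<alpha> = stab_F E (oA N Q \<alpha>) (oeta N Q \<alpha>) (ophi N Q \<alpha>)"

definition oSset ::
    "('g, 'f) sd_data \<Rightarrow> ('g, 'f, 'q, 'i, 'v, 'w, 'n) gobj \<Rightarrow> 'q \<Rightarrow> 'i idx \<Rightarrow> ('g \<times> 'f) set" where
  "oSset E N Q \<alpha> = stab_S E (oA N Q \<alpha>) (oeta N Q \<alpha>) (ophi N Q \<alpha>)"

definition oS ::
    "('g, 'f) sd_data \<Rightarrow> ('g, 'f, 'q, 'i, 'v, 'w, 'n) gobj \<Rightarrow> 'q \<Rightarrow> 'i idx \<Rightarrow> ('g \<times> 'f) monoid" where
  "oS E N Q \<alpha> = (sd_group E)\<lparr>carrier := oSset E N Q \<alpha>\<rparr>"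

definition oStop ::
    "('g, 'f) sd_data \<Rightarrow> ('g, 'f, 'q, 'i, 'v, 'w, 'n) gobj \<Rightarrow> 'q \<Rightarrow> 'i idx \<Rightarrow> ('g \<times> 'f) topology" where
  "oStop E N Q \<alpha> = subtopology (sd_top E) (oSset E N Q \<alpha>)"

definition oB_of ::
    "('g, 'f) sd_data \<Rightarrow> ('g, 'f, 'q, 'i, 'v, 'w, 'n) gobj \<Rightarrow> 'q \<Rightarrow> 'i idx \<Rightarrow> ('g \<times> 'f) measure \<Rightarrow>
     ('g \<times> 'f, 'v) cp calg" where
  "oB_of E N Q \<alpha> \<nu> =
     crossed_product (oS E N Q \<alpha>) (oStop E N Q \<alpha>) \<nu> (oA N Q \<alpha>) (oeta N Q \<alpha>)"

definition oj_of ::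
    "('g, 'f) sd_data \<Rightarrow> ('g, 'f, 'q, 'i, 'v, 'w, 'n) gobj \<Rightarrow> 'q \<Rightarrow> 'i idx \<Rightarrow> ('g \<times> 'f) measure \<Rightarrow>
     'v \<Rightarrow> (('g \<times> 'f, 'v) cp \<Rightarrow> ('g \<times> 'f, 'v) cp) \<times> (('g \<times> 'f, 'v) cp \<Rightarrow> ('g \<times> 'f, 'v) cp)" where
  "oj_of E N Q \<alpha> \<nu> = cp_mult (oS E N Q \<alpha>) (oStop E N Q \<alpha>) \<nu> (oA N Q \<alpha>) (oeta N Q \<alpha>)"

abbreviation oB ::
    "('g, 'f) sd_data \<Rightarrow> ('g, 'f, 'q, 'i, 'v, 'w, 'n) gobj \<Rightarrow> 'q \<Rightarrow> 'i idx \<Rightarrow> ('g \<times> 'f, 'v) cp calg" where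
  "oB E N Q \<alpha> \<equiv> oB_of E N Q \<alpha> (omu N Q \<alpha>)"

definition oR ::
    "('g, 'f) sd_data \<Rightarrow> ('g, 'f, 'q, 'i, 'v, 'w, 'n) gobj \<Rightarrow> 'q \<Rightarrow> 'i idx \<Rightarrow>
     ('g \<times> 'f, 'v) cp \<Rightarrow> 'w \<Rightarrow> 'w" where
  "oR E N Q \<alpha> =
     cp_rep (oS E N Q \<alpha>) (oStop E N Q \<alpha>) (omu N Q \<alpha>) (oA N Q \<alpha>) (oeta N Q \<alpha>) (oH N Q \<alpha>) (opi N Q \<alpha>)
       (gns_unitary (oA N Q \<alpha>) (oeta N Q \<alpha>) (oH N Q \<alpha>) (opi N Q \<alpha>) (oOm N Q \<alpha>))"

definition oRplus ::
    "('g, 'f) sd_data \<Rightarrow> ('g, 'f, 'q, 'i, 'v, 'w, 'n) gobj \<Rightarrow> 'q \<Rightarrow> 'i idx \<Rightarrow>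
     ('g \<times> 'f, 'v) cp \<times> complex \<Rightarrow> 'w \<Rightarrow> 'w" where
  "oRplus E N Q \<alpha> = plus_rep (oB E N Q \<alpha>) (oH N Q \<alpha>) (oR E N Q \<alpha>)"

text \<open>Conditions on an object for all \<open>Q\<close> and all indices \<open>\<alpha>\<close> in \<open>I\<^sup>Q\<close>. The equation for
  \<open>\<epsilon>\<close> is one between maps, hence includes the equality of their domains.\<close>

definition gobj_base ::
    "('g, 'f) sd_data \<Rightarrow> ('g, 'f, 'q, 'i, 'v, 'w, 'n) gobj \<Rightarrow> bool" where
  "gobj_base E N \<longleftrightarrow>
     (\<forall>Q\<in>oT N.
        obeta N Q \<in> oI N Q \<and>
        oP N Q = {\<alpha> \<in> oI N Q. oF E N Q (obeta N Q) \<subseteq> oF E N Q \<alpha>} \<and>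
        (\<forall>\<alpha>\<in>oI N Q.
           cdyn_system (sd_group E) (sd_top E) (oA N Q \<alpha>) (oeta N Q \<alpha>) \<and>
           cdyn_system real_group euclideanreal (oA N Q \<alpha>) (oeps N Q \<alpha>) \<and>
           ophi N Q \<alpha> \<in> G_invariant_states E (oA N Q \<alpha>) (oeta N Q \<alpha>) \<and>
           kms_state (oA N Q \<alpha>) (oeps N Q \<alpha>) (ophi N Q \<alpha>)) \<and>
        (\<forall>l\<in>carrier (sd_group E).
           oI N (ob N l Q) = oI N Q \<and> obeta N (ob N l Q) = obeta N Q \<and>
           (\<forall>\<alpha>\<in>oI N Q.
              (\<lambda>h. snd l \<otimes>\<^bsub>grpF E\<^esub> h \<otimes>\<^bsub>grpF E\<^esub> inv\<^bsub>grpF E\<^esub> (snd l)) ` oF E N Q \<alpha> = oF E N (ob N l Q) \<alpha> \<and>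
              (\<forall>t. vcar (oA N (ob N l Q) \<alpha>) = vcar (oA N Q \<alpha>) \<and>
                 (\<forall>a\<in>vcar (oA N Q \<alpha>). oeps N (ob N l Q) \<alpha> t a =
                    oeta N Q \<alpha> l (oeps N Q \<alpha> t (oeta N Q \<alpha> (inv\<^bsub>sd_group E\<^esub> l) a))))))) \<and>
     comm_group (oAb N) \<and>
     opsi N \<in> hom (sd_group E) (AutoGroup (oAb N)) \<and>
     ob N \<in> hom (sd_group E) (BijGroup (oT N)) \<and>
     (\<forall>Q\<in>oT N. \<forall>\<alpha>\<in>oP N Q.
        (\<forall>f\<in>carrier (oAb N). \<forall>f'\<in>carrier (oAb N).
           om N (f \<otimes>\<^bsub>oAb N\<^esub> f') Q \<alpha> = om N f Q \<alpha> + om N f' Q \<alpha>) \<and>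
        (\<forall>f\<in>carrier (oAb N). om N f Q \<alpha> \<in> \<int>) \<and>
        (\<forall>f\<in>carrier (oAb N). \<forall>l\<in>carrier (sd_group E).
           om N (opsi N l f) Q \<alpha> = om N f (ob N (inv\<^bsub>sd_group E\<^esub> l) Q) \<alpha>))"

text \<open>Conditions for the data attached to indices \<open>\<alpha>\<close> in \<open>P\<^sup>Q\<close>.\<close>

definition gobj_cycles ::
    "('g, 'f) sd_data \<Rightarrow> ('g, 'f, 'q, 'i, 'v, 'w, 'n) gobj \<Rightarrow> bool" where
  "gobj_cycles E N \<longleftrightarrow>
     (\<forall>Q\<in>oT N. \<forall>\<alpha>\<in>oP N Q.
        haar_measure (oS E N Q \<alpha>) (oStop E N Q \<alpha>) (omu N Q \<alpha>) \<and>
        ou N Q \<alpha> \<in> Hom (oAb N) (K0 (unitization (oB E N Q \<alpha>))) \<and>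
        gns_triple (oA N Q \<alpha>) (ophi N Q \<alpha>) (oH N Q \<alpha>) (opi N Q \<alpha>) (oOm N Q \<alpha>) \<and>
        even_theta_K_cycle (unitization (oB E N Q \<alpha>)) (oH N Q \<alpha>) (oRplus E N Q \<alpha>)
          (oD N Q \<alpha>) (oGam N Q \<alpha>) \<and>
        (\<forall>f\<in>carrier (oAb N). complex_of_real (om N f Q \<alpha>) =
           connes_pairing (ou N Q \<alpha> f) (unitization (oB E N Q \<alpha>))
             (chern_character (unitization (oB E N Q \<alpha>)) (oH N Q \<alpha>) (oRplus E N Q \<alpha>)
                (oD N Q \<alpha>) (oGam N Q \<alpha>))))"

definition gobj_equivariance ::
    "('g, 'f) sd_data \<Rightarrow> ('g, 'f, 'q, 'i, 'v, 'w, 'n) gobj \<Rightarrow> bool" where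
  "gobj_equivariance E N \<longleftrightarrow>
     (\<forall>Q\<in>oT N. \<forall>\<alpha>\<in>oP N Q.
        ov N Q \<alpha> \<one>\<^bsub>sd_group E\<^esub> = (\<lambda>x\<in>vcar (oH N Q \<alpha>). x) \<and>
        ow N Q \<alpha> \<one>\<^bsub>sd_group E\<^esub> = (\<lambda>x\<in>vcar (oB E N Q \<alpha>). x) \<and>
        oz N Q \<alpha> \<one>\<^bsub>sd_group E\<^esub> = (\<lambda>x\<in>vcar (oA N Q \<alpha>). x) \<and>
        (\<forall>l\<in>carrier (sd_group E).
           let Ql = ob N l Q in
           ov N Q \<alpha> l \<in> unitaries (oH N Q \<alpha>) (oH N Ql \<alpha>) \<and>
           ow N Q \<alpha> l \<in> star_homs (oB E N Q \<alpha>) (oB E N Ql \<alpha>) \<and>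
           oz N Q \<alpha> l \<in> star_homs (oA N Q \<alpha>) (oA N Ql \<alpha>) \<and>
           (\<forall>h\<in>carrier (sd_group E). \<forall>a\<in>vcar (oA N Q \<alpha>).
              oeta N Ql \<alpha> h (oz N Q \<alpha> l a) = oz N Q \<alpha> l (oeta N Q \<alpha> h a)) \<and>
           (\<forall>h\<in>carrier (sd_group E).
              ov N Q \<alpha> (h \<otimes>\<^bsub>sd_group E\<^esub> l) = compose (vcar (oH N Q \<alpha>)) (ov N Ql \<alpha> h) (ov N Q \<alpha> l) \<and>
              ow N Q \<alpha> (h \<otimes>\<^bsub>sd_group E\<^esub> l) = compose (vcar (oB E N Q \<alpha>)) (ow N Ql \<alpha> h) (ow N Q \<alpha> l) \<and>
              oz N Q \<alpha> (h \<otimes>\<^bsub>sd_group E\<^esub> l) = compose (vcar (oA N Q \<alpha>)) (oz N Ql \<alpha> h) (oz N Q \<alpha> l)) \<and>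
           fst (oD N Ql \<alpha>) = ov N Q \<alpha> l ` fst (oD N Q \<alpha>) \<and>
           (\<forall>x\<in>fst (oD N Q \<alpha>). snd (oD N Ql \<alpha>) (ov N Q \<alpha> l x) = ov N Q \<alpha> l (snd (oD N Q \<alpha>) x)) \<and>
           (\<forall>x\<in>vcar (oH N Q \<alpha>). oGam N Ql \<alpha> (ov N Q \<alpha> l x) = ov N Q \<alpha> l (oGam N Q \<alpha> x)) \<and>
           (\<forall>b\<in>vcar (oB E N Q \<alpha>). \<forall>x\<in>vcar (oH N Q \<alpha>).
              oR E N Ql \<alpha> (ow N Q \<alpha> l b) (ov N Q \<alpha> l x) = ov N Q \<alpha> l (oR E N Q \<alpha> b x)) \<and>
           (\<forall>f\<in>carrier (oAb N). ou N Ql \<alpha> (opsi N l f) =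
              K0_map (unitization (oB E N Q \<alpha>)) (unitization (oB E N Ql \<alpha>))
                (plus_hom (oB E N Q \<alpha>) (ow N Q \<alpha> l)) (ou N Q \<alpha> f)) \<and>
           (\<forall>a\<in>vcar (oA N Q \<alpha>).
              mult_ext (oB E N Q \<alpha>) (oB E N Ql \<alpha>)
                (compose (vcar (oB E N Q \<alpha>)) (mult_embed (oB E N Ql \<alpha>)) (ow N Q \<alpha> l))
                (oj_of E N Q \<alpha> (omu N Q \<alpha>) a) =
              oj_of E N Ql \<alpha> (omu N Ql \<alpha>) (oeta N Ql \<alpha> l (oz N Q \<alpha> l a)))))"

record ('g, 'f, 'q, 'i, 'v, 'w, 'n) gmor =
  gdom :: "('g, 'f, 'q, 'i, 'v, 'w, 'n) gobj"
  gcod :: "('g, 'f, 'q, 'i, 'v, 'w, 'n) gobj"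
  gfst :: "'n \<Rightarrow> 'n"
  gsnd :: "'q \<Rightarrow> 'q"

definition GG_objs :: "('g, 'f) sd_data \<Rightarrow> ('g, 'f, 'q, 'i, 'v, 'w, 'n) gobj set" where
  "GG_objs E = {N. gobj_base E N \<and> gobj_cycles E N \<and> gobj_equivariance E N}"

definition GG_mors :: "('g, 'f) sd_data \<Rightarrow> ('g, 'f, 'q, 'i, 'v, 'w, 'n) gmor set" where
  "GG_mors E = {t. gdom t \<in> GG_objs E \<and> gcod t \<in> GG_objs E \<and>
     gfst t \<in> Hom (oAb (gdom t)) (oAb (gcod t)) \<and>
     gsnd t \<in> oT (gcod t) \<rightarrow>\<^sub>E oT (gdom t) \<and>
     (\<forall>Q\<in>oT (gcod t). oP (gdom t) (gsnd t Q) = oP (gcod t) Q \<and>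
        (\<forall>f\<in>carrier (oAb (gdom t)). \<forall>\<alpha>\<in>oP (gcod t) Q.
           om (gcod t) (gfst t f) Q \<alpha> = om (gdom t) f (gsnd t Q) \<alpha>))}"

definition GG ::
    "('g, 'f) sd_data \<Rightarrow> (('g, 'f, 'q, 'i, 'v, 'w, 'n) gobj, ('g, 'f, 'q, 'i, 'v, 'w, 'n) gmor) cat" where
  "GG E =
     \<lparr>Obj = GG_objs E, Mor = GG_mors E, dom = gdom, cod = gcod,
      idm = (\<lambda>N. \<lparr>gdom = N, gcod = N, gfst = (\<lambda>f\<in>carrier (oAb N). f), gsnd = (\<lambda>Q\<in>oT N. Q)\<rparr>),
      cmp = (\<lambda>t s. \<lparr>gdom = gdom s, gcod = gcod t,
        gfst = compose (carrier (oAb (gdom s))) (gfst t) (gfst s),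
        gsnd = compose (oT (gcod t)) (gsnd s) (gsnd t)\<rparr>)\<rparr>"

text \<open>\<open>A\<^sup>*\<close>, \<open>V(N)\<close>, \<open>Z(N)\<close> and the action \<open>V\<^sub>\<diamond>\<close>.\<close>

definition A_star :: "('g, 'f, 'q, 'i, 'v, 'w, 'n) gobj \<Rightarrow> ('n \<Rightarrow> real) set" where
  "A_star N = Hom (oAb N) real_group"

definition V_map ::
    "('g, 'f, 'q, 'i, 'v, 'w, 'n) gobj \<Rightarrow> 'q \<Rightarrow> 'i idx \<Rightarrow> 'g \<times> 'f \<Rightarrow> 'v \<Rightarrow> 'v" where
  "V_map N Q \<alpha> l = compose (vcar (oA N Q \<alpha>)) (oz N Q \<alpha> l) (oeta N Q \<alpha> l)"

definition Z_set :: "('g, 'f, 'q, 'i, 'v, 'w, 'n) gobj \<Rightarrow> ('q \<times> ('i idx \<Rightarrow> 'v \<Rightarrow> complex)) set" where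
  "Z_set N = (SIGMA Q:oT N. \<Pi>\<^sub>E \<beta>\<in>oP N Q. dual (oA N Q \<beta>))"

definition V_diamond ::
    "('g, 'f) sd_data \<Rightarrow> ('g, 'f, 'q, 'i, 'v, 'w, 'n) gobj \<Rightarrow> 'g \<times> 'f \<Rightarrow>
     'q \<times> ('i idx \<Rightarrow> 'v \<Rightarrow> complex) \<Rightarrow> 'q \<times> ('i idx \<Rightarrow> 'v \<Rightarrow> complex)" where
  "V_diamond E N l = (\<lambda>(Q, f).
     (ob N l Q, \<lambda>\<alpha>\<in>oP N (ob N l Q). compose (vcar (oA N (ob N l Q) \<alpha>)) (f \<alpha>)
        (V_map N (ob N l Q) \<alpha> (inv\<^bsub>sd_group E\<^esub> l))))"

text \<open>
  The set \<open>Rep(c)\<close> of tuples \<open>(Q, \<alpha>, \<nu>, u, (H, \<pi>, \<Omega>), \<Phi>)\<close>. The requirement that the restriction of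
  \<open>\<Phi>\<^sub>0\<^sup>\<natural>\<close> to \<open>B\<close> be a state of \<open>B\<close> is what makes its extension to \<open>M(B)\<close> defined; it would also
  follow from the normality condition for the norm preserving extension.
\<close>

definition nu_functional ::
    "('g, 'f) sd_data \<Rightarrow> ('g, 'f, 'q, 'i, 'v, 'w, 'n) gobj \<Rightarrow> 'q \<Rightarrow> 'i idx \<Rightarrow> ('g \<times> 'f) measure \<Rightarrow>
     ((('g \<times> 'f, 'v) cp \<times> complex) list \<Rightarrow> complex) \<Rightarrow> ('g \<times> 'f, 'v) cp \<Rightarrow> complex" where
  "nu_functional E N Q \<alpha> \<nu> \<Phi> =
     (let B = oB_of E N Q \<alpha> \<nu>;
          \<Phi>0 = (\<lambda>x\<in>vcar (unitization B). \<Phi> [x])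
      in (\<lambda>b\<in>vcar B. natural_state (unitization B) \<Phi>0 (b, 0)))"

definition varrho ::
    "('g, 'f) sd_data \<Rightarrow> ('g, 'f, 'q, 'i, 'v, 'w, 'n) gobj \<Rightarrow> 'q \<Rightarrow> 'i idx \<Rightarrow> ('g \<times> 'f) measure \<Rightarrow>
     ((('g \<times> 'f, 'v) cp \<times> complex) list \<Rightarrow> complex) \<Rightarrow> 'v \<Rightarrow> complex" where
  "varrho E N Q \<alpha> \<nu> \<Phi> = (\<lambda>a\<in>vcar (oA N Q \<alpha>).
     state_ext (oB_of E N Q \<alpha> \<nu>) (nu_functional E N Q \<alpha> \<nu> \<Phi>) (oj_of E N Q \<alpha> \<nu> a))"

definition Rep ::
    "('g, 'f) sd_data \<Rightarrow> ('g, 'f, 'q, 'i, 'v, 'w, 'n) gobj \<Rightarrow> ('n \<Rightarrow> real) \<Rightarrow>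
     ('q \<times> 'i idx \<times> ('g \<times> 'f) measure \<times> ('n \<Rightarrow> (('g \<times> 'f, 'v) cp \<times> complex) k0) \<times>
      ('w hsp \<times> ('v \<Rightarrow> 'w \<Rightarrow> 'w) \<times> 'w) \<times> ((('g \<times> 'f, 'v) cp \<times> complex) list \<Rightarrow> complex)) set" where
  "Rep E N c = {(Q, \<alpha>, \<nu>, u, (H, \<pi>, \<Omega>), \<Phi>).
     Q \<in> oT N \<and> \<alpha> \<in> oP N Q \<and>
     haar_measure (oS E N Q \<alpha>) (oStop E N Q \<alpha>) \<nu> \<and>
     u \<in> Hom (oAb N) (K0 (unitization (oB_of E N Q \<alpha> \<nu>))) \<and>
     gns_triple (oA N Q \<alpha>) (ophi N Q \<alpha>) H \<pi> \<Omega> \<and>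
     even_entire_cocycle (unitization (oB_of E N Q \<alpha> \<nu>)) \<Phi> \<and>
     normalized_cocycle (unitization (oB_of E N Q \<alpha> \<nu>)) \<Phi> \<and>
     (\<exists>b\<in>vcar (oB_of E N Q \<alpha> \<nu>). \<Phi> [(b, 0)] \<noteq> 0) \<and>
     is_state (oB_of E N Q \<alpha> \<nu>) (nu_functional E N Q \<alpha> \<nu> \<Phi>) \<and>
     rep_normal (oA N Q \<alpha>) H \<pi> (varrho E N Q \<alpha> \<nu> \<Phi>) \<and>
     (\<forall>f\<in>carrier (oAb N). c f = Re (connes_pairing (u f) (unitization (oB_of E N Q \<alpha> \<nu>))
        (ecc_class (unitization (oB_of E N Q \<alpha> \<nu>)) \<Phi>)))}"

definition varrho_of ::
    "('g, 'f) sd_data \<Rightarrow> ('g, 'f, 'q, 'i, 'v, 'w, 'n) gobj \<Rightarrow>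
     ('q \<times> 'i idx \<times> ('g \<times> 'f) measure \<times> ('n \<Rightarrow> (('g \<times> 'f, 'v) cp \<times> complex) k0) \<times>
      ('w hsp \<times> ('v \<Rightarrow> 'w \<Rightarrow> 'w) \<times> 'w) \<times> ((('g \<times> 'f, 'v) cp \<times> complex) list \<Rightarrow> complex)) \<Rightarrow>
     'v \<Rightarrow> complex" where
  "varrho_of E N = (\<lambda>(Q, \<alpha>, \<nu>, u, K, \<Phi>). varrho E N Q \<alpha> \<nu> \<Phi>)"

definition NN ::
    "('g, 'f) sd_data \<Rightarrow> ('g, 'f, 'q, 'i, 'v, 'w, 'n) gobj \<Rightarrow> ('n \<Rightarrow> real) \<Rightarrow> ('v \<Rightarrow> complex) set" where
  "NN E N c = varrho_of E N ` Rep E N c"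


section \<open>Nucleon-fragment doublets\<close>

text \<open>The tuple \<open>\<langle>S, J, Z, \<S>, F, m, W, H, D, U\<rangle>\<close>; the symmetry map is constantly
  \<^term>\<open>sd_group E\<close> and is therefore no component. \<open>D\<close> and \<open>U\<close> are partial functions.\<close>

record ('o, 'm, 'g, 'f, 'q, 'i, 'v, 'w, 'n) doublet =
  tS :: "('o, 'm, 'n \<Rightarrow> real) psh"
  tJ :: "('o, 'm, 'q \<times> ('i idx \<Rightarrow> 'v \<Rightarrow> complex)) psh"
  tZ :: "('o, 'm, 'q \<times> ('i idx \<Rightarrow> 'v \<Rightarrow> complex)) psh"
  tSS :: "'m \<Rightarrow> 'q \<Rightarrow> 'i idx \<Rightarrow> 'v \<Rightarrow> 'v"
  tF :: "('o, 'm, ('g, 'f, 'q, 'i, 'v, 'w, 'n) gobj, ('g, 'f, 'q, 'i, 'v, 'w, 'n) gmor) fct"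
  tm :: "'o \<Rightarrow> 'q \<Rightarrow> 'i idx \<Rightarrow> 'n \<Rightarrow> real"
  tW :: "'o \<Rightarrow> 'q \<Rightarrow> 'i idx \<Rightarrow> 'v \<Rightarrow> complex"
  tD :: "('g, 'f, 'q, 'i, 'v, 'w, 'n) gobj \<rightharpoonup> 'q set"
  tU :: "('g, 'f, 'q, 'i, 'v, 'w, 'n) gobj \<rightharpoonup> 'q set"

abbreviation tN ::
    "('o, 'm, 'g, 'f, 'q, 'i, 'v, 'w, 'n) doublet \<Rightarrow> 'o \<Rightarrow> ('g, 'f, 'q, 'i, 'v, 'w, 'n) gobj" where
  "tN T a \<equiv> fobj (tF T) a"

abbreviation tF1 :: "('o, 'm, 'g, 'f, 'q, 'i, 'v, 'w, 'n) doublet \<Rightarrow> 'm \<Rightarrow> 'n \<Rightarrow> 'n" where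
  "tF1 T t \<equiv> gfst (fmor (tF T) t)"

abbreviation tF2 :: "('o, 'm, 'g, 'f, 'q, 'i, 'v, 'w, 'n) doublet \<Rightarrow> 'm \<Rightarrow> 'q \<Rightarrow> 'q" where
  "tF2 T t \<equiv> gsnd (fmor (tF T) t)"

abbreviation tDset :: "('o, 'm, 'g, 'f, 'q, 'i, 'v, 'w, 'n) doublet \<Rightarrow> 'o \<Rightarrow> 'q set" where
  "tDset T a \<equiv> the (tD T (tN T a))"

abbreviation tUset :: "('o, 'm, 'g, 'f, 'q, 'i, 'v, 'w, 'n) doublet \<Rightarrow> 'o \<Rightarrow> 'q set" where
  "tUset T a \<equiv> the (tU T (tN T a))"

text \<open>\<open>\<Theta> = F\<^sup>-\<^sup>1(Dom U)\<close> and \<open>\<Xi> = F\<^sup>-\<^sup>1(Dom(D)\<^sup>0)\<close>.\<close>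

definition Theta ::
    "('o, 'm) cat \<Rightarrow> ('o, 'm, 'g, 'f, 'q, 'i, 'v, 'w, 'n) doublet \<Rightarrow> ('o, 'm) cat" where
  "Theta C T = C\<lparr>Obj := {a \<in> Obj C. tN T a \<in> Map.dom (tU T)},
     Mor := {t \<in> Mor C. tN T (dom C t) \<in> Map.dom (tU T) \<and> tN T (cod C t) \<in> Map.dom (tU T)}\<rparr>"

definition Xi ::
    "('o, 'm) cat \<Rightarrow> ('o, 'm, 'g, 'f, 'q, 'i, 'v, 'w, 'n) doublet \<Rightarrow> ('o, 'm) cat" where
  "Xi C T = C\<lparr>Obj := {a \<in> Obj C. tN T a \<in> Map.dom (tD T)},
     Mor := {t \<in> Mor C. tN T (dom C t) \<in> Map.dom (tD T) \<and> tN T (cod C t) \<in> Map.dom (tD T) \<and>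
       tF2 T t ` tDset T (cod C t) \<subseteq> tDset T (dom C t)}\<rparr>"

definition doublet_DU ::
    "('g, 'f) sd_data \<Rightarrow> ('o, 'm, 'g, 'f, 'q, 'i, 'v, 'w, 'n) doublet \<Rightarrow> bool" where
  "doublet_DU E T \<longleftrightarrow>
     Map.dom (tU T) \<subseteq> GG_objs E \<and>
     (\<forall>N\<in>Map.dom (tU T). the (tU T N) \<subseteq> oT N) \<and>
     (\<forall>t\<in>GG_mors E. gdom t \<in> Map.dom (tU T) \<and> gcod t \<in> Map.dom (tU T) \<longrightarrow>
        gsnd t ` the (tU T (gcod t)) \<subseteq> the (tU T (gdom t))) \<and>
     Map.dom (tD T) \<subseteq> Map.dom (tU T) \<and>
     (\<forall>N\<in>Map.dom (tD T). the (tD T N) \<subseteq> the (tU T N) \<and>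
        (\<forall>l\<in>carrier (sd_group E). ob N l ` the (tD T N) \<subseteq> the (tD T N)))"

definition doublet_S_m ::
    "('g, 'f) sd_data \<Rightarrow> ('o, 'm) cat \<Rightarrow> ('o, 'm, 'g, 'f, 'q, 'i, 'v, 'w, 'n) doublet \<Rightarrow> bool" where
  "doublet_S_m E C T \<longleftrightarrow>
     presheaf (Theta C T) (tS T) \<and>
     (\<forall>a\<in>Obj (Theta C T). pobj (tS T) a \<subseteq> A_star (tN T a) \<and>
        (\<forall>h\<in>carrier (sd_group E).
           (\<lambda>u. compose (carrier (oAb (tN T a))) u (opsi (tN T a) (inv\<^bsub>sd_group E\<^esub> h))) ` pobj (tS T) a
             = pobj (tS T) a)) \<and>
     (\<forall>t\<in>Mor (Theta C T). \<forall>u\<in>pobj (tS T) (cod C t).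
        pmap (tS T) t u = compose (carrier (oAb (tN T (dom C t)))) u (tF1 T t)) \<and>
     (\<forall>a\<in>Obj (Theta C T). \<forall>Q\<in>tUset T a. \<forall>\<alpha>\<in>oP (tN T a) Q.
        tm T a Q \<alpha> \<in> pobj (tS T) a \<and>
        (\<forall>l\<in>carrier (sd_group E). tm T a (ob (tN T a) l Q) \<alpha> =
           compose (carrier (oAb (tN T a))) (tm T a Q \<alpha>) (opsi (tN T a) (inv\<^bsub>sd_group E\<^esub> l)))) \<and>
     (\<forall>t\<in>Mor (Theta C T). \<forall>Q\<in>tUset T (cod C t). \<forall>\<alpha>\<in>oP (tN T (cod C t)) Q.
        tm T (dom C t) (tF2 T t Q) \<alpha> =
          compose (carrier (oAb (tN T (dom C t)))) (tm T (cod C t) Q \<alpha>) (tF1 T t))"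

definition doublet_Z_J ::
    "('g, 'f) sd_data \<Rightarrow> ('o, 'm) cat \<Rightarrow> ('o, 'm, 'g, 'f, 'q, 'i, 'v, 'w, 'n) doublet \<Rightarrow> bool" where
  "doublet_Z_J E C T \<longleftrightarrow>
     presheaf (Xi C T) (tZ T) \<and>
     (\<forall>b\<in>Obj (Xi C T). pobj (tZ T) b = Z_set (tN T b)) \<and>
     (\<forall>t\<in>Mor (Xi C T). \<forall>Q\<in>oT (tN T (cod C t)). \<forall>\<beta>\<in>oP (tN T (cod C t)) Q.
        tSS T t Q \<beta> \<in> star_homs (oA (tN T (dom C t)) (tF2 T t Q) \<beta>) (oA (tN T (cod C t)) Q \<beta>)) \<and>
     (\<forall>t\<in>Mor (Xi C T). \<forall>s\<in>Mor (Xi C T). cod C s = dom C t \<longrightarrow>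
        (\<forall>Q\<in>oT (tN T (cod C t)). \<forall>\<beta>\<in>oP (tN T (cod C t)) Q.
           tSS T (cmp C t s) Q \<beta> =
             compose (vcar (oA (tN T (dom C s)) (tF2 T s (tF2 T t Q)) \<beta>))
               (tSS T t Q \<beta>) (tSS T s (tF2 T t Q) \<beta>))) \<and>
     (\<forall>t\<in>Mor (Xi C T). \<forall>(Q, f)\<in>Z_set (tN T (cod C t)).
        pmap (tZ T) t (Q, f) = (tF2 T t Q, \<lambda>\<beta>\<in>oP (tN T (cod C t)) Q.
          compose (vcar (oA (tN T (dom C t)) (tF2 T t Q) \<beta>)) (f \<beta>) (tSS T t Q \<beta>))) \<and>
     presheaf (Xi C T) (tJ T) \<and>
     (\<forall>b\<in>Obj (Xi C T). pobj (tJ T) b \<subseteq> pobj (tZ T) b \<and>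
        pobj (tJ T) b \<subseteq>
          (SIGMA Q:tDset T b. \<Pi>\<^sub>E \<beta>\<in>oP (tN T b) Q. NN E (tN T b) (tm T b Q \<beta>)) \<and>
        (\<forall>l\<in>carrier (sd_group E). V_diamond E (tN T b) l ` pobj (tJ T) b = pobj (tJ T) b)) \<and>
     (\<forall>t\<in>Mor (Xi C T). \<forall>x\<in>pobj (tJ T) (cod C t). pmap (tJ T) t x = pmap (tZ T) t x)"

definition doublet_W ::
    "('g, 'f) sd_data \<Rightarrow> ('o, 'm) cat \<Rightarrow> ('o, 'm, 'g, 'f, 'q, 'i, 'v, 'w, 'n) doublet \<Rightarrow> bool" where
  "doublet_W E C T \<longleftrightarrow>
     (\<forall>b\<in>Obj (Xi C T). \<forall>Q\<in>tDset T b.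
        (Q, \<lambda>\<beta>\<in>oP (tN T b) Q. tW T b Q \<beta>) \<in> pobj (tJ T) b \<and>
        (\<forall>\<beta>\<in>oP (tN T b) Q.
           tW T b Q \<beta> \<in> NN E (tN T b) (tm T b Q \<beta>) \<and>
           (\<exists>r\<in>Rep E (tN T b) (tm T b Q \<beta>). fst r = Q \<and> fst (snd r) = \<beta> \<and>
              tW T b Q \<beta> = varrho_of E (tN T b) r) \<and>
           (\<forall>l\<in>carrier (sd_group E). tW T b (ob (tN T b) l Q) \<beta> =
              compose (vcar (oA (tN T b) (ob (tN T b) l Q) \<beta>)) (tW T b Q \<beta>)
                (V_map (tN T b) (ob (tN T b) l Q) \<beta> (inv\<^bsub>sd_group E\<^esub> l))))) \<and>
     (\<forall>t\<in>Mor (Xi C T). \<forall>Q\<in>tDset T (cod C t). \<forall>\<beta>\<in>oP (tN T (cod C t)) Q.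
        tW T (dom C t) (tF2 T t Q) \<beta> =
          compose (vcar (oA (tN T (dom C t)) (tF2 T t Q) \<beta>)) (tW T (cod C t) Q \<beta>) (tSS T t Q \<beta>))"

definition nucleon_fragment_doublet ::
    "('g, 'f) sd_data \<Rightarrow> ('o, 'm) cat \<Rightarrow> ('o, 'm, 'g, 'f, 'q, 'i, 'v, 'w, 'n) doublet \<Rightarrow> bool" where
  "nucleon_fragment_doublet E C T \<longleftrightarrow>
     is_functor C (GG E) (tF T) \<and>
     doublet_DU E T \<and> doublet_S_m E C T \<and> doublet_Z_J E C T \<and> doublet_W E C T"


section \<open>Fission processes\<close>

datatype mw = Idx_m | Idx_w

record ('o, 'q, 'i, 'v, 'n) fission =
  na :: 'o
  nQ :: 'q
  nal :: "'i idx"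
  nf :: "mw \<Rightarrow> 'n"
  nN :: "mw \<Rightarrow> 'v"

abbreviation tA ::
    "('o, 'm, 'g, 'f, 'q, 'i, 'v, 'w, 'n) doublet \<Rightarrow> 'o \<Rightarrow> 'q \<Rightarrow> 'i idx \<Rightarrow> 'v calg" where
  "tA T a Q \<alpha> \<equiv> oA (tN T a) Q \<alpha>"

text \<open>The value of a state on a positive element is real; it is taken as a real number by
  \<^const>\<open>Re\<close>.\<close>

definition zeta ::
    "('o, 'm, 'g, 'f, 'q, 'i, 'v, 'w, 'n) doublet \<Rightarrow> mw \<Rightarrow> ('o, 'q, 'i, 'v, 'n) fission \<Rightarrow> real" where
  "zeta T j x = tm T (na x) (nQ x) (nal x) (nf x j)"

definition kappa ::
    "('o, 'm, 'g, 'f, 'q, 'i, 'v, 'w, 'n) doublet \<Rightarrow> mw \<Rightarrow> ('o, 'q, 'i, 'v, 'n) fission \<Rightarrow> real" where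
  "kappa T j x = Re (tW T (na x) (nQ x) (nal x) (nN x j))"

definition nu ::
    "('o, 'm, 'g, 'f, 'q, 'i, 'v, 'w, 'n) doublet \<Rightarrow> ('o, 'q, 'i, 'v, 'n) fission \<Rightarrow> real" where
  "nu T x = 0.08 * (kappa T Idx_m x - zeta T Idx_m x) + 0.1 * (kappa T Idx_w x - zeta T Idx_w x)"

definition N_as ::
    "('o, 'm) cat \<Rightarrow> ('o, 'm, 'g, 'f, 'q, 'i, 'v, 'w, 'n) doublet \<Rightarrow> ('o, 'q, 'i, 'v, 'n) fission set" where
  "N_as C T = {x.
     na x \<in> Obj (Xi C T) \<and> nQ x \<in> tDset T (na x) \<and> nal x \<in> oP (tN T (na x)) (nQ x) \<and>
     (\<exists>r>0. nal x = Inl r) \<and>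
     (\<forall>j. nf x j \<in> carrier (oAb (tN T (na x))) \<and>
          nN x j \<in> pos_cone (tA T (na x) (nQ x) (nal x)) \<and>
          zeta T j x \<le> kappa T j x) \<and>
     zeta T Idx_m x \<le> zeta T Idx_w x \<and> 0 \<le> zeta T Idx_m x \<and>
     (\<forall>t\<in>Mor (Xi C T). cod C t = na x \<longrightarrow> (\<forall>j.
        {f \<in> carrier (oAb (tN T (dom C t))). tF1 T t f = nf x j} \<noteq> {} \<and>
        {y \<in> pos_cone (tA T (dom C t) (tF2 T t (nQ x)) (nal x)).
           tSS T t (nQ x) (nal x) y = nN x j} \<noteq> {}))}"

definition N_as_at ::
    "('o, 'm) cat \<Rightarrow> ('o, 'm, 'g, 'f, 'q, 'i, 'v, 'w, 'n) doublet \<Rightarrow> 'o \<Rightarrow> ('o, 'q, 'i, 'v, 'n) fission set" where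
  "N_as_at C T a = {x \<in> N_as C T. na x = a}"

definition kk ::
    "('o, 'm, 'g, 'f, 'q, 'i, 'v, 'w, 'n) doublet \<Rightarrow> 'g \<times> 'f \<Rightarrow>
     ('o, 'q, 'i, 'v, 'n) fission \<Rightarrow> ('o, 'q, 'i, 'v, 'n) fission" where
  "kk T l x = \<lparr>na = na x, nQ = ob (tN T (na x)) l (nQ x), nal = nal x,
     nf = (\<lambda>j. opsi (tN T (na x)) l (nf x j)),
     nN = (\<lambda>j. V_map (tN T (na x)) (nQ x) (nal x) l (nN x j))\<rparr>"

definition fission_pull ::
    "('o, 'm) cat \<Rightarrow> ('o, 'm, 'g, 'f, 'q, 'i, 'v, 'w, 'n) doublet \<Rightarrow> 'm \<Rightarrow>
     ('o, 'q, 'i, 'v, 'n) fission \<Rightarrow> ('o, 'q, 'i, 'v, 'n) fission set" where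
  "fission_pull C T t x = {\<lparr>na = dom C t, nQ = tF2 T t (nQ x), nal = nal x, nf = f, nN = y\<rparr> | f y.
     \<forall>j. f j \<in> carrier (oAb (tN T (dom C t))) \<and> tF1 T t (f j) = nf x j \<and>
         y j \<in> pos_cone (tA T (dom C t) (tF2 T t (nQ x)) (nal x)) \<and>
         tSS T t (nQ x) (nal x) (y j) = nN x j}"

text \<open>
  The defining conditions of \<^const>\<open>N_as\<close> ask for preimages of \<open>f\<^sub>j\<close> and \<open>N\<^sub>j\<close> only; they do not
  force the elements of \<^const>\<open>fission_pull\<close>, nor the images under \<^const>\<open>kk\<close>, to satisfy them
  again. That the following data form a functor to sets, and that \<open>tau\<close> below is a group action
  on its values, are therefore properties in their own right (\<^const>\<open>presheaf\<close>, \<^const>\<open>is_Kset\<close>).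
\<close>

definition PP ::
    "('o, 'm) cat \<Rightarrow> ('o, 'm, 'g, 'f, 'q, 'i, 'v, 'w, 'n) doublet \<Rightarrow>
     ('o, 'm, ('o, 'q, 'i, 'v, 'n) fission set) psh" where
  "PP C T = \<lparr>pobj = (\<lambda>a. Pow (N_as_at C T a)),
     pmap = (\<lambda>t Y. \<Union>x\<in>Y. fission_pull C T t x)\<rparr>"

definition RR :: "('o, 'm, real set) psh" where
  "RR = \<lparr>pobj = (\<lambda>a. Pow UNIV), pmap = (\<lambda>t Y. Y)\<rparr>"

definition tau ::
    "('o, 'm, 'g, 'f, 'q, 'i, 'v, 'w, 'n) doublet \<Rightarrow> 'g \<times> 'f \<Rightarrow>
     ('o, 'q, 'i, 'v, 'n) fission set \<Rightarrow> ('o, 'q, 'i, 'v, 'n) fission set" where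
  "tau T l Y = {kk T l y | y. y \<in> Y}"

definition mu_T ::
    "('o, 'm, 'g, 'f, 'q, 'i, 'v, 'w, 'n) doublet \<Rightarrow> mw \<Rightarrow> 'o \<Rightarrow>
     ('o, 'q, 'i, 'v, 'n) fission set \<Rightarrow> real set" where
  "mu_T T j a Y = {zeta T j y | y. y \<in> Y}"

definition lambda_T ::
    "('o, 'm, 'g, 'f, 'q, 'i, 'v, 'w, 'n) doublet \<Rightarrow> mw \<Rightarrow> 'o \<Rightarrow>
     ('o, 'q, 'i, 'v, 'n) fission set \<Rightarrow> real set" where
  "lambda_T T j a Y = {kappa T j y | y. y \<in> Y}"

definition theta_T ::
    "('o, 'm, 'g, 'f, 'q, 'i, 'v, 'w, 'n) doublet \<Rightarrow> 'o \<Rightarrow>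
     ('o, 'q, 'i, 'v, 'n) fission set \<Rightarrow> real set" where
  "theta_T T a Y = {nu T y | y. y \<in> Y}"

end

theory Submission
  imports Defs
begin

text \<open>
  All the maps in question are direct images \<open>Y \<mapsto> g(Y)\<close> of a real-valued function \<open>g\<close> of a single
  fission process, so it suffices that \<open>g\<close> is invariant under pullback along \<open>\<Xi>\<close> and under
  \<^const>\<open>kk\<close>. Naturality also needs every pullback set to be nonempty: this is what the preimage
  conditions in \<^const>\<open>N_as\<close> are for. Invariance under \<open>H\<close> rests on \<open>V(l\<^sup>-\<^sup>1) \<circ> V(l) = id\<close>, because
  \<open>z(l)\<close> intertwines the two actions of \<open>H\<close> and is a cocycle.
\<close>

section \<open>The semidirect product as a group\<close>

lemma sd_group_group:
  assumes G: "group (grpG E)" and F: "group (grpF E)"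
    and rho: "rho E \<in> hom (grpF E) (AutoGroup (grpG E))"
  shows "group (sd_group E)"
proof -
  interpret G: group "grpG E" by fact
  interpret F: group "grpF E" by fact
  interpret A: group "AutoGroup (grpG E)" by (rule G.AutoGroup)
  interpret r: group_hom "grpF E" "AutoGroup (grpG E)" "rho E"
    by unfold_locales (rule rho)
  let ?G = "grpG E" and ?F = "grpF E"
  \<comment> \<open>The homomorphism into \<open>AutoGroup\<close> is first translated into
    pointwise rules for \<open>rho E h g\<close>, the form in which the product of
    \<open>sd_group\<close> uses it.\<close>
  have hom: "rho E h \<in> hom ?G ?G" if "h \<in> carrier ?F" for h
    using r.hom_closed[OF that] by (auto simp: AutoGroup_def auto_def)
  have cl: "rho E h g \<in> carrier ?G" if "h \<in> carrier ?F" "g \<in> carrier ?G" for h g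
    using hom[OF that(1)] that(2) by (auto simp: hom_def)
  have add: "rho E h (g \<otimes>\<^bsub>?G\<^esub> g') = rho E h g \<otimes>\<^bsub>?G\<^esub> rho E h g'"
    if "h \<in> carrier ?F" "g \<in> carrier ?G" "g' \<in> carrier ?G" for h g g'
    using hom[OF that(1)] that(2,3) by (auto simp: hom_def)
  have mult: "rho E (h \<otimes>\<^bsub>?F\<^esub> h') g = rho E h (rho E h' g)"
    if "h \<in> carrier ?F" "h' \<in> carrier ?F" "g \<in> carrier ?G" for h h' g
    using r.hom_mult[OF that(1,2)] r.hom_closed[OF that(1)] r.hom_closed[OF that(2)] that(3)
    by (simp add: AutoGroup_def BijGroup_def auto_def compose_eq)
  have one: "rho E \<one>\<^bsub>?F\<^esub> g = g" if "g \<in> carrier ?G" for g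
    using r.hom_one that by (simp add: AutoGroup_def BijGroup_def)
  have r1: "rho E h \<one>\<^bsub>?G\<^esub> = \<one>\<^bsub>?G\<^esub>" if "h \<in> carrier ?F" for h
    by (rule hom_one[OF hom[OF that] G G])
  show ?thesis
  proof (rule groupI)
    fix x assume x: "x \<in> carrier (sd_group E)"
    obtain g h where gh: "x = (g, h)" "g \<in> carrier ?G" "h \<in> carrier ?F"
      using x by (auto simp: sd_group_def)
    \<comment> \<open>A left inverse suffices for \<open>groupI\<close>. The first coordinate of the
      product is rho(h^-1)(g^-1) rho(h^-1)(g), which \<open>add\<close>, read from right to left,
      contracts to rho(h^-1)(1). Without \<open>simp del\<close>, rho(h^-1) would become an inverse
      in \<open>AutoGroup\<close>, out of reach of the pointwise rules.\<close>
    let ?y = "(rho E (inv\<^bsub>?F\<^esub> h) (inv\<^bsub>?G\<^esub> g), inv\<^bsub>?F\<^esub> h)"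
    have "?y \<in> carrier (sd_group E)" "?y \<otimes>\<^bsub>sd_group E\<^esub> x = \<one>\<^bsub>sd_group E\<^esub>"
      using gh by (auto simp: sd_group_def cl r1 simp del: r.hom_inv simp flip: add)
    then show "\<exists>y\<in>carrier (sd_group E). y \<otimes>\<^bsub>sd_group E\<^esub> x = \<one>\<^bsub>sd_group E\<^esub>" by blast
  qed (auto simp: sd_group_def cl add mult one G.m_assoc F.m_assoc simp del: r.hom_one r.hom_mult)
qed

section \<open>Objects of \<open>GG\<close>: carriers, and cancellation of l against its
  inverse\<close>

lemma compose_app: "x \<in> A \<Longrightarrow> compose A f g x = f (g x)"
  by (simp add: compose_def)

lemma star_homs_closed: "f \<in> star_homs A B \<Longrightarrow> x \<in> vcar A \<Longrightarrow> f x \<in> vcar B"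
  by (auto simp: star_homs_def linear_maps_def)

lemma pos_cone_subset: "cstar_algebra A \<Longrightarrow> pos_cone A \<subseteq> vcar A"
  by (auto simp: pos_cone_def cstar_algebra_def)

text \<open>By the object axioms \<open>oP\<close> is a subset of \<open>oI\<close>, on which the
  dynamical systems are given.\<close>

lemma cstar_oA:
  assumes "N \<in> GG_objs E" "Q \<in> oT N" "\<alpha> \<in> oP N Q"
  shows "cstar_algebra (oA N Q \<alpha>)"
  using assms
  by (auto simp: GG_objs_def gobj_base_def cdyn_system_def unital_cstar_algebra_def)

lemma opsi_closed:
  assumes "N \<in> GG_objs E" "l \<in> carrier (sd_group E)" "f \<in> carrier (oAb N)"
  shows "opsi N l f \<in> carrier (oAb N)"
proof -
  have "opsi N l \<in> carrier (AutoGroup (oAb N))"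
    using assms(1,2) by (auto simp: GG_objs_def gobj_base_def hom_def)
  then show ?thesis
    using assms(3) by (auto simp: AutoGroup_def auto_def hom_def)
qed

lemma opsi_inv:
  assumes N: "N \<in> GG_objs E" and H: "group (sd_group E)"
    and l: "l \<in> carrier (sd_group E)" and f: "f \<in> carrier (oAb N)"
  shows "opsi N (inv\<^bsub>sd_group E\<^esub> l) (opsi N l f) = f"
proof -
  interpret H: group "sd_group E" by fact
  interpret Ab: group "oAb N"
    using N by (auto simp: GG_objs_def gobj_base_def comm_group_def)
  interpret A: group "AutoGroup (oAb N)" by (rule Ab.AutoGroup)
  interpret p: group_hom "sd_group E" "AutoGroup (oAb N)" "opsi N"
    using N by unfold_locales (auto simp: GG_objs_def gobj_base_def)
  have "opsi N (inv\<^bsub>sd_group E\<^esub> l) \<otimes>\<^bsub>AutoGroup (oAb N)\<^esub> opsi N l = \<one>\<^bsub>AutoGroup (oAb N)\<^esub>"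
    using l by (simp flip: p.hom_mult)
  \<comment> \<open>The product of \<open>BijGroup\<close> is restricted to bijections, so both
    memberships are needed to unfold it to \<open>compose\<close>.\<close>
  moreover have "opsi N l \<in> carrier (AutoGroup (oAb N))"
      "opsi N (inv\<^bsub>sd_group E\<^esub> l) \<in> carrier (AutoGroup (oAb N))"
    using l by auto
  ultimately have "compose (carrier (oAb N)) (opsi N (inv\<^bsub>sd_group E\<^esub> l)) (opsi N l) =
      (\<lambda>x\<in>carrier (oAb N). x)"
    by (simp add: AutoGroup_def BijGroup_def auto_def)
  from fun_cong[OF this, of f] f show ?thesis by (simp add: compose_app)
qed

lemma oeta_inv:
  assumes N: "N \<in> GG_objs E" and H: "group (sd_group E)" and Q: "Q \<in> oT N" "\<alpha> \<in> oP N Q"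
    and l: "l \<in> carrier (sd_group E)" and a: "a \<in> vcar (oA N Q \<alpha>)"
  shows "oeta N Q \<alpha> (inv\<^bsub>sd_group E\<^esub> l) (oeta N Q \<alpha> l a) = a"
    and "oeta N Q \<alpha> l a \<in> vcar (oA N Q \<alpha>)"
proof -
  let ?A = "vcar (oA N Q \<alpha>)"
  interpret H: group "sd_group E" by fact
  have "oeta N Q \<alpha> \<in> hom (sd_group E) (BijGroup ?A)"
    using N Q by (auto simp: GG_objs_def gobj_base_def cdyn_system_def)
  then interpret e: group_hom "sd_group E" "BijGroup ?A" "oeta N Q \<alpha>"
    by (simp add: group_hom_def group_hom_axioms_def H group_BijGroup)
  have "oeta N Q \<alpha> (inv\<^bsub>sd_group E\<^esub> l) \<otimes>\<^bsub>BijGroup ?A\<^esub> oeta N Q \<alpha> l = \<one>\<^bsub>BijGroup ?A\<^esub>"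
    using l by (simp flip: e.hom_mult)
  moreover have B: "oeta N Q \<alpha> l \<in> carrier (BijGroup ?A)"
      "oeta N Q \<alpha> (inv\<^bsub>sd_group E\<^esub> l) \<in> carrier (BijGroup ?A)"
    using l by auto
  ultimately have "compose ?A (oeta N Q \<alpha> (inv\<^bsub>sd_group E\<^esub> l)) (oeta N Q \<alpha> l) = (\<lambda>x\<in>?A. x)"
    by (simp add: BijGroup_def)
  from fun_cong[OF this, of a] a
  show "oeta N Q \<alpha> (inv\<^bsub>sd_group E\<^esub> l) (oeta N Q \<alpha> l a) = a" by (simp add: compose_app)
  show "oeta N Q \<alpha> l a \<in> ?A"
    using B(1) a by (auto simp: BijGroup_def Bij_def bij_betw_def)
qed

text \<open>With eta' and z' taken at \<open>ob N l Q\<close>, the intertwining relation moves eta'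
  past z: z'(l^-1) eta'(l^-1) z(l) eta(l) a = z'(l^-1) z(l) eta(l^-1) eta(l) a = z(1) a = a. The
  membership is what allows the composite \<open>V_map\<close> at \<open>ob N l Q\<close>,
  restricted to the carrier, to be evaluated.\<close>

lemma V_map_inv:
  assumes N: "N \<in> GG_objs E" and H: "group (sd_group E)" and Q: "Q \<in> oT N" "\<alpha> \<in> oP N Q"
    and l: "l \<in> carrier (sd_group E)" and a: "a \<in> vcar (oA N Q \<alpha>)"
  shows "V_map N (ob N l Q) \<alpha> (inv\<^bsub>sd_group E\<^esub> l) (V_map N Q \<alpha> l a) = a"
    and "V_map N Q \<alpha> l a \<in> vcar (oA N (ob N l Q) \<alpha>)"
proof -
  interpret H: group "sd_group E" by fact
  let ?Ql = "ob N l Q" and ?l' = "inv\<^bsub>sd_group E\<^esub> l"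
  note eta = oeta_inv[OF N H Q l a]
  have eq: "gobj_equivariance E N" using N by (simp add: GG_objs_def)
  have z: "oz N Q \<alpha> l \<in> star_homs (oA N Q \<alpha>) (oA N ?Ql \<alpha>)"
    and comm: "\<And>h b. h \<in> carrier (sd_group E) \<Longrightarrow> b \<in> vcar (oA N Q \<alpha>) \<Longrightarrow>
      oeta N ?Ql \<alpha> h (oz N Q \<alpha> l b) = oz N Q \<alpha> l (oeta N Q \<alpha> h b)"
    and zz: "\<And>h. h \<in> carrier (sd_group E) \<Longrightarrow>
      oz N Q \<alpha> (h \<otimes>\<^bsub>sd_group E\<^esub> l) = compose (vcar (oA N Q \<alpha>)) (oz N ?Ql \<alpha> h) (oz N Q \<alpha> l)"
    and z1: "oz N Q \<alpha> \<one>\<^bsub>sd_group E\<^esub> = (\<lambda>x\<in>vcar (oA N Q \<alpha>). x)"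
    using bspec[OF bspec[OF eq[unfolded gobj_equivariance_def Let_def] Q(1)] Q(2)] l
    by simp_all
  show cl: "V_map N Q \<alpha> l a \<in> vcar (oA N ?Ql \<alpha>)"
    using a eta(2) by (simp add: V_map_def compose_app star_homs_closed[OF z])
  \<comment> \<open>The cocycle identity at h = l^-1, where z(l^-1 l) = z(1) is the identity on the
    carrier.\<close>
  have "oz N ?Ql \<alpha> ?l' (oz N Q \<alpha> l a) = a"
    using fun_cong[OF zz[of ?l'], of a] l a z1 by (simp add: compose_app)
  then show "V_map N ?Ql \<alpha> ?l' (V_map N Q \<alpha> l a) = a"
    using cl a l eta comm by (simp add: V_map_def compose_app)
qed

section \<open>From invariant functions of single processes to natural and equivariant maps\<close>

lemma is_Kset_trivial:
  assumes "group K"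
  shows "is_Kset K UNIV (\<lambda>l Y. Y)"
proof -
  have id: "(\<lambda>Y. Y) \<in> Bij UNIV" by (simp add: Bij_def bij_betw_def)
  have "(\<lambda>l. \<lambda>Y\<in>UNIV. Y) \<in> hom K (BijGroup UNIV)"
    by (auto simp: hom_def BijGroup_def id compose_def restrict_UNIV)
  then show ?thesis
    by (simp add: is_Kset_def group_action_def group_hom_def group_hom_axioms_def assms
        group_BijGroup)
qed

lemma presheaf_RR: "presheaf D RR"
  by (simp add: presheaf_def RR_def)

text \<open>Only x is required to satisfy the conditions of \<open>N_as\<close>. The pulled back or
  translated process enters as a bare record, so nothing about its membership in \<open>N_as\<close>
  has to be shown.\<close>

definition fission_invariant ::
    "('g, 'f) sd_data \<Rightarrow> ('o, 'm) cat \<Rightarrow> ('o, 'm, 'g, 'f, 'q, 'i, 'v, 'w, 'n) doublet \<Rightarrow>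
     (('o, 'q, 'i, 'v, 'n) fission \<Rightarrow> real) \<Rightarrow> bool" where
  "fission_invariant E C T g \<longleftrightarrow>
     (\<forall>t\<in>Mor (Xi C T). \<forall>x\<in>N_as_at C T (cod C t). \<forall>y\<in>fission_pull C T t x. g y = g x) \<and>
     (\<forall>l\<in>carrier (sd_group E). \<forall>x\<in>N_as C T. g (kk T l x) = g x)"

lemma fission_pull_nonempty:
  assumes "t \<in> Mor (Xi C T)" "x \<in> N_as_at C T (cod C t)"
  shows "fission_pull C T t x \<noteq> {}"
proof -
  have "\<forall>j. \<exists>f y. f \<in> carrier (oAb (tN T (dom C t))) \<and> tF1 T t f = nf x j \<and>
      y \<in> pos_cone (tA T (dom C t) (tF2 T t (nQ x)) (nal x)) \<and> tSS T t (nQ x) (nal x) y = nN x j"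
    (is "\<forall>j. ?P j")
  proof
    fix j
    have "\<forall>j. {f \<in> carrier (oAb (tN T (dom C t))). tF1 T t f = nf x j} \<noteq> {} \<and>
        {y \<in> pos_cone (tA T (dom C t) (tF2 T t (nQ x)) (nal x)).
           tSS T t (nQ x) (nal x) y = nN x j} \<noteq> {}"
      using assms by (simp add: N_as_at_def N_as_def)
    from spec[OF this, of j] show "?P j" by blast
  qed
  \<comment> \<open>Choice over j assembles the separate preimages into the two functions on
    \<open>mw\<close> that one fission record requires.\<close>
  then obtain f y where "\<forall>j. f j \<in> carrier (oAb (tN T (dom C t))) \<and> tF1 T t (f j) = nf x j \<and>
      y j \<in> pos_cone (tA T (dom C t) (tF2 T t (nQ x)) (nal x)) \<and>
      tSS T t (nQ x) (nal x) (y j) = nN x j"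
    by metis
  then show ?thesis unfolding fission_pull_def by blast
qed

lemma fission_invariant_natural:
  assumes g: "fission_invariant E C T g" and \<xi>: "\<And>a Y. \<xi> a Y = g ` Y"
  shows "natural (Xi C T) (PP C T) RR \<xi>"
proof -
  have "g ` (\<Union>x\<in>Y. fission_pull C T t x) = g ` Y"
    if t: "t \<in> Mor (Xi C T)" and Y: "Y \<subseteq> N_as_at C T (cod C t)" for t Y
  proof -
    \<comment> \<open>Invariance gives one inclusion and nonemptiness the other; an empty pullback
      would lose the value g x.\<close>
    have "g ` fission_pull C T t x = {g x}" if "x \<in> Y" for x
    proof -
      have x: "x \<in> N_as_at C T (cod C t)" using Y that by blast
      have "\<forall>y\<in>fission_pull C T t x. g y = g x"
        using g t x by (simp add: fission_invariant_def)
      with fission_pull_nonempty[OF t x] show ?thesis by force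
    qed
    then show ?thesis by (auto simp: image_UN)
  qed
  \<comment> \<open>Restriction maps of \<open>RR\<close> are identities, so naturality is equality
    of direct images; \<open>Xi\<close> inherits \<open>dom\<close> and \<open>cod\<close> from
    C.\<close>
  then show ?thesis
    by (auto simp: natural_def PP_def RR_def \<xi> Xi_def)
qed

lemma fission_invariant_equivariant:
  assumes g: "fission_invariant E C T g" and \<xi>: "\<And>a Y. \<xi> a Y = g ` Y"
  shows "equivariant (sd_group E) (pobj (PP C T) a) (tau T) UNIV (\<lambda>l Y. Y) (\<xi> a)"
proof -
  have "g ` tau T l Y = g ` Y" if "l \<in> carrier (sd_group E)" "Y \<subseteq> N_as_at C T a" for l Y
  proof -
    have "tau T l Y = kk T l ` Y" by (auto simp: tau_def)
    moreover have "g (kk T l y) = g y" if "y \<in> Y" for y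
      using g \<open>l \<in> _\<close> \<open>Y \<subseteq> _\<close> that unfolding fission_invariant_def N_as_at_def by blast
    ultimately show ?thesis by (simp add: image_image)
  qed
  then show ?thesis by (simp add: equivariant_def PP_def \<xi>)
qed

section \<open>Transfer of indices from \<open>Xi\<close> to \<open>Theta\<close> and
  \<open>GG\<close>\<close>

lemma doublet_DU_subset:
  assumes "doublet_DU E T" "N \<in> Map.dom (tD T)"
  shows "N \<in> GG_objs E" "N \<in> Map.dom (tU T)"
    "the (tD T N) \<subseteq> the (tU T N)" "the (tU T N) \<subseteq> oT N"
  using assms unfolding doublet_DU_def by blast+

text \<open>The conditions on m are imposed over \<open>Theta\<close> and U, and those of
  \<open>GG\<close> over \<open>oT\<close>, whereas processes live over \<open>Xi\<close> and D. The
  inclusions of D in U and of U in \<open>oT\<close> connect them.\<close>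

lemma Xi_in_GG:
  assumes "nucleon_fragment_doublet E C T" "a \<in> Obj (Xi C T)" "Q \<in> tDset T a"
  shows "tN T a \<in> GG_objs E" "Q \<in> tUset T a" "Q \<in> oT (tN T a)" "a \<in> Obj (Theta C T)"
  using assms
proof -
  have DU: "doublet_DU E T" using assms(1) by (simp add: nucleon_fragment_doublet_def)
  have a: "a \<in> Obj C" "tN T a \<in> Map.dom (tD T)" using assms(2) by (simp_all add: Xi_def)
  note N = doublet_DU_subset[OF DU a(2)]
  show "tN T a \<in> GG_objs E" "Q \<in> tUset T a" "Q \<in> oT (tN T a)" "a \<in> Obj (Theta C T)"
    using N assms(3) a(1) by (auto simp: Theta_def)
qed

text \<open>The index remains admissible after pullback because a morphism of \<open>GG\<close>
  preserves the sets \<open>oP\<close> along its second component.\<close>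

lemma Xi_Mor_in_GG:
  assumes "nucleon_fragment_doublet E C T" "t \<in> Mor (Xi C T)" "Q \<in> tDset T (cod C t)"
    "\<alpha> \<in> oP (tN T (cod C t)) Q"
  shows "tN T (dom C t) \<in> GG_objs E" "Q \<in> tUset T (cod C t)" "t \<in> Mor (Theta C T)"
    "tF2 T t Q \<in> oT (tN T (dom C t))" "\<alpha> \<in> oP (tN T (dom C t)) (tF2 T t Q)"
proof -
  have DU: "doublet_DU E T" and fn: "is_functor C (GG E) (tF T)"
    using assms(1) by (auto simp: nucleon_fragment_doublet_def)
  have t: "t \<in> Mor C" "tN T (dom C t) \<in> Map.dom (tD T)" "tN T (cod C t) \<in> Map.dom (tD T)"
    using assms(2) by (auto simp: Xi_def)
  show 1: "tN T (dom C t) \<in> GG_objs E" "Q \<in> tUset T (cod C t)" "t \<in> Mor (Theta C T)"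
    using doublet_DU_subset[OF DU t(2)] doublet_DU_subset[OF DU t(3)] t(1) assms(3)
    by (auto simp: Theta_def)
  have QT: "Q \<in> oT (tN T (cod C t))"
    using doublet_DU_subset[OF DU t(3)] 1(2) by blast
  have "fmor (tF T) t \<in> GG_mors E" "gdom (fmor (tF T) t) = tN T (dom C t)"
    "gcod (fmor (tF T) t) = tN T (cod C t)"
    using fn t(1) by (auto simp: is_functor_def GG_def)
  with QT assms(4) show "tF2 T t Q \<in> oT (tN T (dom C t))" "\<alpha> \<in> oP (tN T (dom C t)) (tF2 T t Q)"
    by (auto simp: GG_mors_def)
qed

section \<open>Invariance of the values of m and W\<close>

lemma zeta_invariant:
  assumes T: "nucleon_fragment_doublet E C T" and H: "group (sd_group E)"
  shows "fission_invariant E C T (zeta T j)"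
  unfolding fission_invariant_def
proof (intro conjI ballI)
  have Sm: "doublet_S_m E C T" using T by (simp add: nucleon_fragment_doublet_def)
  fix t x y
  assume t: "t \<in> Mor (Xi C T)" and x: "x \<in> N_as_at C T (cod C t)" and y: "y \<in> fission_pull C T t x"
  have nx: "na x = cod C t" "nQ x \<in> tDset T (cod C t)" "nal x \<in> oP (tN T (cod C t)) (nQ x)"
    using x by (auto simp: N_as_at_def N_as_def)
  note X = Xi_Mor_in_GG[OF T t nx(2,3)]
  have yf: "na y = dom C t" "nQ y = tF2 T t (nQ x)" "nal y = nal x"
    "nf y j \<in> carrier (oAb (tN T (dom C t)))" "tF1 T t (nf y j) = nf x j"
    using y by (auto simp: fission_pull_def)
  \<comment> \<open>Evaluated at a preimage of \<open>nf x j\<close> under \<open>tF1 T t\<close>,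
    the right-hand side is \<open>zeta T j x\<close>.\<close>
  have "tm T (dom C t) (tF2 T t (nQ x)) (nal x) =
      compose (carrier (oAb (tN T (dom C t)))) (tm T (cod C t) (nQ x) (nal x)) (tF1 T t)"
    using Sm X(2,3) nx(3) unfolding doublet_S_m_def by blast
  then show "zeta T j y = zeta T j x"
    using yf nx(1) by (simp add: zeta_def compose_app)
next
  have Sm: "doublet_S_m E C T" using T by (simp add: nucleon_fragment_doublet_def)
  fix l x assume l: "l \<in> carrier (sd_group E)" and x: "x \<in> N_as C T"
  have nx: "na x \<in> Obj (Xi C T)" "nQ x \<in> tDset T (na x)" "nal x \<in> oP (tN T (na x)) (nQ x)"
    "nf x j \<in> carrier (oAb (tN T (na x)))"
    using x by (auto simp: N_as_def)
  note X = Xi_in_GG[OF T nx(1,2)]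
  \<comment> \<open>At psi(l) f the factor psi(l^-1) cancels, by \<open>opsi_inv\<close>.\<close>
  have "tm T (na x) (ob (tN T (na x)) l (nQ x)) (nal x) =
      compose (carrier (oAb (tN T (na x)))) (tm T (na x) (nQ x) (nal x))
        (opsi (tN T (na x)) (inv\<^bsub>sd_group E\<^esub> l))"
    using Sm X(2,4) nx(3) l unfolding doublet_S_m_def by blast
  then show "zeta T j (kk T l x) = zeta T j x"
    using opsi_closed[OF X(1) l nx(4)] opsi_inv[OF X(1) H l nx(4)]
    by (simp add: zeta_def kk_def compose_app)
qed

lemma kappa_invariant:
  assumes T: "nucleon_fragment_doublet E C T" and H: "group (sd_group E)"
  shows "fission_invariant E C T (kappa T j)"
  unfolding fission_invariant_def
proof (intro conjI ballI)
  have W: "doublet_W E C T" using T by (simp add: nucleon_fragment_doublet_def)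
  fix t x y
  assume t: "t \<in> Mor (Xi C T)" and x: "x \<in> N_as_at C T (cod C t)" and y: "y \<in> fission_pull C T t x"
  have nx: "na x = cod C t" "nQ x \<in> tDset T (cod C t)" "nal x \<in> oP (tN T (cod C t)) (nQ x)"
    using x by (auto simp: N_as_at_def N_as_def)
  note X = Xi_Mor_in_GG[OF T t nx(2,3)]
  have yN: "na y = dom C t" "nQ y = tF2 T t (nQ x)" "nal y = nal x"
    "nN y j \<in> pos_cone (tA T (dom C t) (tF2 T t (nQ x)) (nal x))"
    "tSS T t (nQ x) (nal x) (nN y j) = nN x j"
    using y by (auto simp: fission_pull_def)
  \<comment> \<open>The compatibility of W with \<open>tSS\<close> is an equation between maps
    restricted to the carrier, so the positive preimage must first be placed there.\<close>
  have "nN y j \<in> vcar (tA T (dom C t) (tF2 T t (nQ x)) (nal x))"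
    using yN(4) pos_cone_subset[OF cstar_oA[OF X(1,4,5)]] by blast
  moreover have "tW T (dom C t) (tF2 T t (nQ x)) (nal x) =
      compose (vcar (tA T (dom C t) (tF2 T t (nQ x)) (nal x)))
        (tW T (cod C t) (nQ x) (nal x)) (tSS T t (nQ x) (nal x))"
    using W t nx(2,3) unfolding doublet_W_def by blast
  ultimately show "kappa T j y = kappa T j x"
    using yN nx(1) by (simp add: kappa_def compose_app)
next
  have W: "doublet_W E C T" using T by (simp add: nucleon_fragment_doublet_def)
  fix l x assume l: "l \<in> carrier (sd_group E)" and x: "x \<in> N_as C T"
  have nx: "na x \<in> Obj (Xi C T)" "nQ x \<in> tDset T (na x)" "nal x \<in> oP (tN T (na x)) (nQ x)"
    "nN x j \<in> pos_cone (tA T (na x) (nQ x) (nal x))"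
    using x by (auto simp: N_as_def)
  note X = Xi_in_GG[OF T nx(1,2)]
  have "nN x j \<in> vcar (tA T (na x) (nQ x) (nal x))"
    using nx(4) pos_cone_subset[OF cstar_oA[OF X(1,3) nx(3)]] by blast
  note V = V_map_inv[OF X(1) H X(3) nx(3) l this]
  \<comment> \<open>At V(l) N the inner map V(l^-1) returns N, by \<open>V_map_inv\<close>.\<close>
  have "tW T (na x) (ob (tN T (na x)) l (nQ x)) (nal x) =
      compose (vcar (tA T (na x) (ob (tN T (na x)) l (nQ x)) (nal x))) (tW T (na x) (nQ x) (nal x))
        (V_map (tN T (na x)) (ob (tN T (na x)) l (nQ x)) (nal x) (inv\<^bsub>sd_group E\<^esub> l))"
    using W nx(1-3) l unfolding doublet_W_def by blast
  then show "kappa T j (kk T l x) = kappa T j x"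
    using V by (simp add: kappa_def kk_def compose_app)
qed

lemma nu_invariant:
  assumes "nucleon_fragment_doublet E C T" "group (sd_group E)"
  shows "fission_invariant E C T (nu T)"
  using zeta_invariant[OF assms] kappa_invariant[OF assms]
  by (simp add: fission_invariant_def nu_def)

text \<open>The equations, in \<open>natural\<close> and \<open>equivariant\<close>, are asserted
  outright. Membership in \<open>presheaf_mor\<close> and \<open>Kset_mor\<close> also contains that
  the source is a presheaf or an H-set, which the conditions of \<open>N_as\<close> do not state, so
  that part carries it as a premise.\<close>

theorem theorem3p3p23:
  fixes E :: "('g, 'f) sd_data"
    and C :: "('o, 'm) cat"
    and T :: "('o, 'm, 'g, 'f, 'q, 'i, 'v, 'w, 'n) doublet"
  assumes "locally_compact_group (grpG E) (topG E)"
    and "locally_compact_group (grpF E) (topF E)"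
    and "rho E \<in> hom (grpF E) (AutoGroup (grpG E))"
    and "continuous_map (prod_topology (topG E) (topF E)) (topG E) (\<lambda>(g, f). rho E f g)"
    and "category C"
    and "nucleon_fragment_doublet E C T"
  shows
    "\<forall>\<xi> \<in> range (mu_T T) \<union> range (lambda_T T) \<union> {theta_T T}.
       natural (Xi C T) (PP C T) RR \<xi> \<and>
       (presheaf (Xi C T) (PP C T) \<longrightarrow> \<xi> \<in> presheaf_mor (Xi C T) (PP C T) RR) \<and>
       (\<forall>a \<in> Obj (Xi C T).
          equivariant (sd_group E) (pobj (PP C T) a) (tau T) UNIV (\<lambda>l Y. Y) (\<xi> a) \<and>
          (is_Kset (sd_group E) (pobj (PP C T) a) (tau T) \<longrightarrow>
             \<xi> a \<in> Kset_mor (sd_group E) (pobj (PP C T) a) (tau T) UNIV (\<lambda>l Y. Y)))"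
proof
  have H: "group (sd_group E)"
    using assms(1-3) by (intro sd_group_group) (auto simp: locally_compact_group_def)
  fix \<xi> assume "\<xi> \<in> range (mu_T T) \<union> range (lambda_T T) \<union> {theta_T T}"
  then consider j where "\<xi> = mu_T T j" | j where "\<xi> = lambda_T T j" | "\<xi> = theta_T T"
    by auto
  then obtain g where g: "fission_invariant E C T g" and \<xi>: "\<And>a Y. \<xi> a Y = g ` Y"
  proof cases
    case (1 j)
    show ?thesis
      by (rule that[OF zeta_invariant[OF assms(6) H, of j]]) (auto simp: 1 mu_T_def)
  next
    case (2 j)
    show ?thesis
      by (rule that[OF kappa_invariant[OF assms(6) H, of j]]) (auto simp: 2 lambda_T_def)
  next
    case 3
    show ?thesis
      by (rule that[OF nu_invariant[OF assms(6) H]]) (auto simp: 3 theta_T_def)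
  qed
  show "natural (Xi C T) (PP C T) RR \<xi> \<and>
       (presheaf (Xi C T) (PP C T) \<longrightarrow> \<xi> \<in> presheaf_mor (Xi C T) (PP C T) RR) \<and>
       (\<forall>a \<in> Obj (Xi C T).
          equivariant (sd_group E) (pobj (PP C T) a) (tau T) UNIV (\<lambda>l Y. Y) (\<xi> a) \<and>
          (is_Kset (sd_group E) (pobj (PP C T) a) (tau T) \<longrightarrow>
             \<xi> a \<in> Kset_mor (sd_group E) (pobj (PP C T) a) (tau T) UNIV (\<lambda>l Y. Y)))"
    using fission_invariant_natural[where \<xi> = \<xi>, OF g \<xi>]
      fission_invariant_equivariant[where \<xi> = \<xi>, OF g \<xi>]
    by (simp add: presheaf_mor_def Kset_mor_def presheaf_RR is_Kset_trivial[OF H])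
qed

end
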